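(* Let $\mathcal{H}$ be an infinite dimensional separable complex Hilbert space, let $A$ be a bounded normal operator on $\mathcal{H}$, and let $G\subset\mathcal{H}$ with $|G|<\infty$. If the system $\{A^n g\}_{g\in G,\, n\ge 0}$ is a frame in $\mathcal{H}$, then $A$ is unitarily equivalent to an operator $\Lambda=\sum_j\lambda_j P_j$ on $\ell^2(\mathbb{N})$, where the $\lambda_j$ are distinct complex numbers and the $P_j$ are nonzero, pairwise orthogonal, orthogonal projections summing (strongly) to the identity, such that $\dim P_j\le |G|$ for every $j$. In particular, if $|G|=1$, then the $\lambda_j$ (indexed by $j\in\mathbb{N}$) satisfy $|\lambda_j|<1$ for all $j$ and $|\lambda_j|\to 1$ as $j\to\infty$.
   Context: The system $\{A^n g\}_{g\in G,\,n\ge 0}$ is regarded as a family indexed by pairs $(g,n)$ with $g\in G$, $n\in\{0,1,2,\dots\}$. It is a frame in $\mathcal{H}$ if there are constants $0<C_1\le C_2<\infty$ such that $C_1\|f\|^2\le \sum_{g\in G}\sum_{n=0}^\infty |\langle f, A^n g\rangle|^2\le C_2\|f\|^2$ for all $f\in\mathcal{H}$. $|G|$ denotes the cardinality of $G$, and $\dim P_j$ denotes the dimension of the range (rank) of $P_j$. The projection $P_j$ is the orthogonal projection onto the eigenspace of $\Lambda$ associated to $\lambda_j$, and the sum $\sum_j\lambda_jP_j$ converges in the strong operator topology. *)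

theory Defs
  imports "HOL-Analysis.Analysis"
begin

section \<open>Complex Hilbert spaces\<close>

text \<open>
  The inner product is linear in the first argument. Positive definiteness is contained in
  \<open>cinner_self\<close>, since the norm is positive definite.
\<close>

class complex_inner = real_normed_vector +
  fixes scaleC :: "complex \<Rightarrow> 'a \<Rightarrow> 'a"  (infixr \<open>*\<^sub>C\<close> 75)
    and cinner :: "'a \<Rightarrow> 'a \<Rightarrow> complex"
  assumes scaleC_add_right: "c *\<^sub>C (x + y) = c *\<^sub>C x + c *\<^sub>C y"
    and scaleC_add_left: "(c + d) *\<^sub>C x = c *\<^sub>C x + d *\<^sub>C x"
    and scaleC_scaleC: "c *\<^sub>C (d *\<^sub>C x) = (c * d) *\<^sub>C x"
    and scaleR_scaleC: "r *\<^sub>R x = complex_of_real r *\<^sub>C x"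
    and cinner_commute: "cinner x y = cnj (cinner y x)"
    and cinner_add_left: "cinner (x + y) z = cinner x z + cinner y z"
    and cinner_scaleC_left: "cinner (c *\<^sub>C x) y = c * cinner x y"
    and cinner_self: "cinner x x = complex_of_real ((norm x)\<^sup>2)"

class chilbert_space = complex_inner + complete_space

global_interpretation complex_vector: vector_space "scaleC :: complex \<Rightarrow> 'a \<Rightarrow> 'a::complex_inner"
  defines cspan = complex_vector.span
    and cdim = complex_vector.dim
proof
  fix c d :: complex and x y :: 'a
  show "c *\<^sub>C (x + y) = c *\<^sub>C x + c *\<^sub>C y" by (rule scaleC_add_right)
  show "(c + d) *\<^sub>C x = c *\<^sub>C x + d *\<^sub>C x" by (rule scaleC_add_left)
  show "c *\<^sub>C (d *\<^sub>C x) = (c * d) *\<^sub>C x" by (rule scaleC_scaleC)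
  show "1 *\<^sub>C x = x" using scaleR_scaleC[of 1 x] by simp
qed

text \<open>
  Since \<^const>\<open>cdim\<close> is 0 on spaces without a finite basis, a bound on the dimension
  must be accompanied by finite dimensionality.
\<close>

definition cfinite_dim :: "'a::complex_inner set \<Rightarrow> bool" where
  "cfinite_dim V \<longleftrightarrow> (\<exists>B. finite B \<and> V \<subseteq> cspan B)"

definition cdim_le :: "'a::complex_inner set \<Rightarrow> nat \<Rightarrow> bool" where
  "cdim_le V n \<longleftrightarrow> cfinite_dim V \<and> cdim V \<le> n"


section \<open>Operators\<close>

definition bounded_clinear :: "('a::complex_inner \<Rightarrow> 'b::complex_inner) \<Rightarrow> bool" where
  "bounded_clinear T \<longleftrightarrow> bounded_linear T \<and> (\<forall>c x. T (c *\<^sub>C x) = c *\<^sub>C T x)"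

definition is_cadjoint :: "('b::complex_inner \<Rightarrow> 'a::complex_inner) \<Rightarrow> ('a \<Rightarrow> 'b) \<Rightarrow> bool" where
  "is_cadjoint S T \<longleftrightarrow> (\<forall>x y. cinner (T x) y = cinner x (S y))"

text \<open>
  An adjoint is unique if it exists, and on a Hilbert space every bounded operator has one.
\<close>

definition normal_op :: "('a::chilbert_space \<Rightarrow> 'a) \<Rightarrow> bool" where
  "normal_op T \<longleftrightarrow> bounded_clinear T \<and> (\<exists>S. is_cadjoint S T \<and> T \<circ> S = S \<circ> T)"

definition unitary_op :: "('a::complex_inner \<Rightarrow> 'b::complex_inner) \<Rightarrow> bool" where
  "unitary_op U \<longleftrightarrow>
     bounded_clinear U \<and> surj U \<and> (\<forall>x y. cinner (U x) (U y) = cinner x y)"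

definition unitarily_equivalent ::
    "('a::complex_inner \<Rightarrow> 'a) \<Rightarrow> ('b::complex_inner \<Rightarrow> 'b) \<Rightarrow> bool" where
  "unitarily_equivalent S T \<longleftrightarrow> (\<exists>U :: 'a \<Rightarrow> 'b. unitary_op U \<and> U \<circ> S = T \<circ> U)"

definition orth_projection :: "('a::complex_inner \<Rightarrow> 'a) \<Rightarrow> bool" where
  "orth_projection P \<longleftrightarrow> bounded_clinear P \<and> P \<circ> P = P \<and> is_cadjoint P P"

definition eigenspace :: "('a::complex_inner \<Rightarrow> 'a) \<Rightarrow> complex \<Rightarrow> 'a set" where
  "eigenspace T l = {x. T x = l *\<^sub>C x}"


section \<open>Frames\<close>

definition is_frame :: "'i set \<Rightarrow> ('i \<Rightarrow> 'a::complex_inner) \<Rightarrow> bool" where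
  "is_frame I \<phi> \<longleftrightarrow>
     (\<exists>C1 C2 :: real. 0 < C1 \<and> C1 \<le> C2 \<and>
       (\<forall>f. (\<lambda>i. (cmod (cinner f (\<phi> i)))\<^sup>2) summable_on I \<and>
            C1 * (norm f)\<^sup>2 \<le> (\<Sum>\<^sub>\<infinity>i\<in>I. (cmod (cinner f (\<phi> i)))\<^sup>2) \<and>
            (\<Sum>\<^sub>\<infinity>i\<in>I. (cmod (cinner f (\<phi> i)))\<^sup>2) \<le> C2 * (norm f)\<^sup>2))"


section \<open>The Hilbert space of square-summable complex sequences\<close>

typedef ell2 = "{x :: nat \<Rightarrow> complex. summable (\<lambda>n. (cmod (x n))\<^sup>2)}"
  morphisms ell2_nth Abs_ell2
  by (rule exI[of _ "\<lambda>_. 0"]) simp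

setup_lifting type_definition_ell2

lemma L2_set_le_of_summable:
  assumes "summable (\<lambda>n. (f n)\<^sup>2)"
  shows "L2_set f {..<N} \<le> sqrt (\<Sum>n. (f n)\<^sup>2)"
  unfolding L2_set_def
  by (intro real_sqrt_le_mono sum_le_suminf[OF assms]) auto

lemma summable_of_L2_set_le:
  assumes "\<And>N. L2_set f {..<N} \<le> K"
  shows "summable (\<lambda>n. (f n)\<^sup>2)" and "sqrt (\<Sum>n. (f n)\<^sup>2) \<le> K"
proof -
  have K: "0 \<le> K" using assms[of 0] by simp
  have b: "(\<Sum>n<N. (f n)\<^sup>2) \<le> K\<^sup>2" for N
    using assms[of N] K unfolding L2_set_def by (simp add: real_sqrt_le_iff' sum_nonneg sqrt_le_D)
  show s: "summable (\<lambda>n. (f n)\<^sup>2)"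
    by (rule summableI_nonneg_bounded[OF _ b]) simp
  have "(\<Sum>n. (f n)\<^sup>2) \<le> K\<^sup>2" by (rule suminf_le_const[OF s b])
  then show "sqrt (\<Sum>n. (f n)\<^sup>2) \<le> K"
    using K by (simp add: real_le_lsqrt)
qed

lemma L2_set_cmod_triangle:
  "L2_set (\<lambda>n. cmod (x n + y n)) A \<le> L2_set (\<lambda>n. cmod (x n)) A + L2_set (\<lambda>n. cmod (y n)) A"
  by (rule order_trans[OF L2_set_mono L2_set_triangle_ineq]) (auto intro: norm_triangle_ineq)

lemma ell2_add_L2_bound:
  assumes "summable (\<lambda>n. (cmod (x n))\<^sup>2)" "summable (\<lambda>n. (cmod (y n))\<^sup>2)"
  shows "L2_set (\<lambda>n. cmod (x n + y n)) {..<N}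
           \<le> sqrt (\<Sum>n. (cmod (x n))\<^sup>2) + sqrt (\<Sum>n. (cmod (y n))\<^sup>2)"
  using L2_set_cmod_triangle[of x y "{..<N}"]
    L2_set_le_of_summable[OF assms(1), of N] L2_set_le_of_summable[OF assms(2), of N]
  by linarith

lemma ell2_scale_summable:
  assumes "summable (\<lambda>n. (cmod (x n))\<^sup>2)"
  shows "summable (\<lambda>n. (cmod (c * x n))\<^sup>2)"
  using summable_mult[OF assms, of "(cmod c)\<^sup>2"] by (simp add: norm_mult power_mult_distrib)

lemma ell2_prod_summable:
  assumes "summable (\<lambda>n. (cmod (x n))\<^sup>2)" "summable (\<lambda>n. (cmod (y n))\<^sup>2)"
  shows "summable (\<lambda>n. x n * cnj (y n))"
proof (rule summable_comparison_test')
  show "summable (\<lambda>n. (cmod (x n))\<^sup>2 + (cmod (y n))\<^sup>2)" by (rule summable_add[OF assms])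
  fix n
  have "2 * (cmod (x n) * cmod (y n)) \<le> (cmod (x n))\<^sup>2 + (cmod (y n))\<^sup>2"
    using sum_squares_bound[of "cmod (x n)" "cmod (y n)"] by simp
  moreover have "0 \<le> cmod (x n) * cmod (y n)" by simp
  ultimately show "norm (x n * cnj (y n)) \<le> (cmod (x n))\<^sup>2 + (cmod (y n))\<^sup>2"
    unfolding norm_mult complex_mod_cnj by linarith
qed

instantiation ell2 :: complex_inner
begin

lift_definition zero_ell2 :: ell2 is "\<lambda>_. 0" by simp

lift_definition plus_ell2 :: "ell2 \<Rightarrow> ell2 \<Rightarrow> ell2" is "\<lambda>x y n. x n + y n"
  by (rule summable_of_L2_set_le(1)[OF ell2_add_L2_bound])

lift_definition uminus_ell2 :: "ell2 \<Rightarrow> ell2" is "\<lambda>x n. - x n" by simp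

lift_definition minus_ell2 :: "ell2 \<Rightarrow> ell2 \<Rightarrow> ell2" is "\<lambda>x y n. x n - y n"
proof -
  fix x y :: "nat \<Rightarrow> complex"
  assume s: "summable (\<lambda>n. (cmod (x n))\<^sup>2)" "summable (\<lambda>n. (cmod (y n))\<^sup>2)"
  then have "summable (\<lambda>n. (cmod (- y n))\<^sup>2)" by simp
  from summable_of_L2_set_le(1)[OF ell2_add_L2_bound[OF s(1) this]]
  show "summable (\<lambda>n. (cmod (x n - y n))\<^sup>2)" by simp
qed

lift_definition scaleC_ell2 :: "complex \<Rightarrow> ell2 \<Rightarrow> ell2" is "\<lambda>c x n. c * x n"
  by (rule ell2_scale_summable)

definition scaleR_ell2 :: "real \<Rightarrow> ell2 \<Rightarrow> ell2" where
  "scaleR_ell2 r x = complex_of_real r *\<^sub>C x"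

lift_definition cinner_ell2 :: "ell2 \<Rightarrow> ell2 \<Rightarrow> complex" is "\<lambda>x y. \<Sum>n. x n * cnj (y n)" .

lift_definition norm_ell2 :: "ell2 \<Rightarrow> real" is "\<lambda>x. sqrt (\<Sum>n. (cmod (x n))\<^sup>2)" .

definition sgn_ell2 :: "ell2 \<Rightarrow> ell2" where "sgn_ell2 x = inverse (norm x) *\<^sub>R x"

definition dist_ell2 :: "ell2 \<Rightarrow> ell2 \<Rightarrow> real" where "dist_ell2 x y = norm (x - y)"

definition uniformity_ell2 :: "(ell2 \<times> ell2) filter" where
  "uniformity_ell2 = (INF e\<in>{0 <..}. principal {(x, y). dist x y < e})"

definition open_ell2 :: "ell2 set \<Rightarrow> bool" where
  "open_ell2 U = (\<forall>x\<in>U. eventually (\<lambda>(x', y). x' = x \<longrightarrow> y \<in> U) uniformity)"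

instance
proof
  fix x y z :: ell2 and a b :: real and c d :: complex and U :: "ell2 set"
  show "x + y + z = x + (y + z)" by transfer (simp add: add.assoc)
  show "x + y = y + x" by transfer (simp add: add.commute)
  show "0 + x = x" by transfer simp
  show "- x + x = 0" by transfer simp
  show "x - y = x + - y" by transfer simp
  show cr: "c *\<^sub>C (x + y) = c *\<^sub>C x + c *\<^sub>C y" for c :: complex and x y :: ell2
    by transfer (simp add: algebra_simps)
  show cl: "(c + d) *\<^sub>C x = c *\<^sub>C x + d *\<^sub>C x" for c d :: complex and x :: ell2
    by transfer (simp add: algebra_simps)
  show cs: "c *\<^sub>C d *\<^sub>C x = (c * d) *\<^sub>C x" for c d :: complex and x :: ell2
    by transfer (simp add: algebra_simps)
  show "a *\<^sub>R (x + y) = a *\<^sub>R x + a *\<^sub>R y" "(a + b) *\<^sub>R x = a *\<^sub>R x + b *\<^sub>R x"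
    "a *\<^sub>R b *\<^sub>R x = (a * b) *\<^sub>R x" "a *\<^sub>R x = complex_of_real a *\<^sub>C x"
    by (simp_all add: scaleR_ell2_def cr cl cs)
  show "1 *\<^sub>R x = x" unfolding scaleR_ell2_def by transfer simp
  show "sgn x = inverse (norm x) *\<^sub>R x" by (rule sgn_ell2_def)
  show "dist x y = norm (x - y)" by (rule dist_ell2_def)
  show "(uniformity :: (ell2 \<times> ell2) filter) = (INF e\<in>{0 <..}. principal {(x, y). dist x y < e})"
    by (rule uniformity_ell2_def)
  show "open U = (\<forall>x\<in>U. eventually (\<lambda>(x', y). x' = x \<longrightarrow> y \<in> U) uniformity)"
    by (rule open_ell2_def)
  show "norm x = 0 \<longleftrightarrow> x = 0"
    by transfer (auto simp: suminf_eq_zero_iff fun_eq_iff)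
  show "norm (x + y) \<le> norm x + norm y"
    by transfer (rule summable_of_L2_set_le(2)[OF ell2_add_L2_bound])
  show "norm (a *\<^sub>R x) = \<bar>a\<bar> * norm x"
    unfolding scaleR_ell2_def
    by transfer (simp add: norm_mult power_mult_distrib suminf_mult real_sqrt_mult)
  show "cinner x y = cnj (cinner y x)"
  proof transfer
    fix x y :: "nat \<Rightarrow> complex"
    assume s: "summable (\<lambda>n. (cmod (x n))\<^sup>2)" "summable (\<lambda>n. (cmod (y n))\<^sup>2)"
    from sums_cnj[THEN iffD2, OF summable_sums[OF ell2_prod_summable[OF s(2,1)]]]
    have "(\<lambda>n. x n * cnj (y n)) sums cnj (\<Sum>n. y n * cnj (x n))"
      by (simp add: mult.commute)
    then show "(\<Sum>n. x n * cnj (y n)) = cnj (\<Sum>n. y n * cnj (x n))"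
      by (simp add: sums_iff)
  qed
  show "cinner (x + y) z = cinner x z + cinner y z"
    by transfer (simp add: algebra_simps suminf_add ell2_prod_summable)
  show "cinner (c *\<^sub>C x) y = c * cinner x y"
    by transfer (simp add: mult.assoc suminf_mult ell2_prod_summable)
  show "cinner x x = complex_of_real ((norm x)\<^sup>2)"
    by transfer
      (simp add: complex_norm_square[symmetric] suminf_of_real suminf_nonneg del: of_real_power)
qed

end

lemma norm_ell2_leI:
  assumes "\<And>N. L2_set (\<lambda>n. cmod (ell2_nth x n)) {..<N} \<le> K"
  shows "norm x \<le> K"
  using summable_of_L2_set_le(2)[OF assms] by (simp add: norm_ell2.rep_eq)

lemma L2_set_le_norm_ell2: "L2_set (\<lambda>n. cmod (ell2_nth x n)) {..<N} \<le> norm x"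
  using L2_set_le_of_summable[of "\<lambda>n. cmod (ell2_nth x n)" N] ell2_nth[of x]
  by (simp add: norm_ell2.rep_eq)

lemma cmod_ell2_nth_le: "cmod (ell2_nth x n) \<le> norm x"
  using L2_set_le_norm_ell2[of x "Suc n"]
    member_le_L2_set[of "{..<Suc n}" n "\<lambda>n. cmod (ell2_nth x n)"]
  by simp

instance ell2 :: chilbert_space
proof
  fix X :: "nat \<Rightarrow> ell2"
  assume C: "Cauchy X"
  have "Cauchy (\<lambda>m. ell2_nth (X m) n)" for n
  proof (rule metric_CauchyI)
    fix e :: real assume "0 < e"
    then obtain M where M: "\<And>i j. i \<ge> M \<Longrightarrow> j \<ge> M \<Longrightarrow> dist (X i) (X j) < e"
      using metric_CauchyD[OF C] by blast
    have "dist (ell2_nth (X i) n) (ell2_nth (X j) n) \<le> dist (X i) (X j)" for i j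
      using cmod_ell2_nth_le[of "X i - X j" n] by (simp add: dist_norm minus_ell2.rep_eq)
    then show "\<exists>M. \<forall>i\<ge>M. \<forall>j\<ge>M. dist (ell2_nth (X i) n) (ell2_nth (X j) n) < e"
      using M by (meson le_less_trans)
  qed
  then have "\<forall>n. \<exists>l. (\<lambda>m. ell2_nth (X m) n) \<longlonglongrightarrow> l"
    using Cauchy_convergent convergent_def by blast
  then obtain l where l: "\<And>n. (\<lambda>m. ell2_nth (X m) n) \<longlonglongrightarrow> l n" by metis
  have key: "\<exists>M. \<forall>m\<ge>M. \<forall>N. L2_set (\<lambda>n. cmod (ell2_nth (X m) n - l n)) {..<N} \<le> e"
    if e: "0 < e" for e
  proof -
    obtain M where M: "\<And>i j. i \<ge> M \<Longrightarrow> j \<ge> M \<Longrightarrow> dist (X i) (X j) < e"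
      using metric_CauchyD[OF C e] by blast
    have "L2_set (\<lambda>n. cmod (ell2_nth (X m) n - l n)) {..<N} \<le> e" if m: "m \<ge> M" for m N
    proof (rule tendsto_upperbound)
      show "(\<lambda>j. L2_set (\<lambda>n. cmod (ell2_nth (X m) n - ell2_nth (X j) n)) {..<N})
              \<longlonglongrightarrow> L2_set (\<lambda>n. cmod (ell2_nth (X m) n - l n)) {..<N}"
        unfolding L2_set_def by (intro tendsto_intros l)
      have "L2_set (\<lambda>n. cmod (ell2_nth (X m) n - ell2_nth (X j) n)) {..<N} \<le> e" if "j \<ge> M" for j
        using L2_set_le_norm_ell2[of "X m - X j" N] M[OF m that]
        by (simp add: minus_ell2.rep_eq dist_norm)
      then show "\<forall>\<^sub>F j in sequentially.
          L2_set (\<lambda>n. cmod (ell2_nth (X m) n - ell2_nth (X j) n)) {..<N} \<le> e"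
        by (rule eventually_sequentiallyI)
    qed simp
    then show ?thesis by blast
  qed
  obtain M where M: "\<And>N. L2_set (\<lambda>n. cmod (ell2_nth (X M) n - l n)) {..<N} \<le> 1"
    using key[of 1] by auto
  have "L2_set (\<lambda>n. cmod (l n)) {..<N} \<le> norm (X M) + 1" for N
  proof -
    have "L2_set (\<lambda>n. cmod (ell2_nth (X M) n + (l n - ell2_nth (X M) n))) {..<N}
        \<le> L2_set (\<lambda>n. cmod (ell2_nth (X M) n)) {..<N}
          + L2_set (\<lambda>n. cmod (l n - ell2_nth (X M) n)) {..<N}"
      by (rule L2_set_cmod_triangle)
    then show ?thesis
      using M[of N] L2_set_le_norm_ell2[of "X M" N] by (simp add: norm_minus_commute)
  qed
  from summable_of_L2_set_le(1)[OF this]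
  have nth: "ell2_nth (Abs_ell2 l) = l" by (simp add: Abs_ell2_inverse)
  have "X \<longlonglongrightarrow> Abs_ell2 l"
  proof (rule metric_LIMSEQ_I)
    fix e :: real assume "0 < e"
    then obtain M where M: "\<And>m N. m \<ge> M \<Longrightarrow>
        L2_set (\<lambda>n. cmod (ell2_nth (X m) n - l n)) {..<N} \<le> e / 2"
      using key[of "e / 2"] by auto
    have "dist (X m) (Abs_ell2 l) < e" if "m \<ge> M" for m
    proof -
      have "norm (X m - Abs_ell2 l) \<le> e / 2"
        using M[OF that] by (intro norm_ell2_leI) (simp only: minus_ell2.rep_eq nth)
      then show ?thesis using \<open>0 < e\<close> by (simp add: dist_norm)
    qed
    then show "\<exists>M. \<forall>m\<ge>M. dist (X m) (Abs_ell2 l) < e" by blast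
  qed
  then show "convergent X" by (rule convergentI)
qed

end

theory Submission
  imports Defs "HOL-Complex_Analysis.Great_Picard"
begin

text \<open>
  Let \<open>B\<close> be the adjoint of \<open>A\<close>. For the quadratic form
  \<open>q x = (\<Sum>g\<in>G. \<Sum>n. \<bar>\<langle>x, A^n g\<rangle>\<bar>\<^sup>2)\<close>, which the frame condition makes equivalent to \<open>\<parallel>x\<parallel>\<^sup>2\<close>,
  the identity \<open>\<langle>B x, A^n g\<rangle> = \<langle>x, A^(n+1) g\<rangle>\<close> says that \<open>B\<close> acts as a shift of the levels \<open>n\<close>:
  \<open>q (B^k x)\<close> is \<open>q x\<close> without its first \<open>k\<close> levels. Everything follows from this in three steps.

  Existence of eigenvectors. Put \<open>T = A B\<close>, and let \<open>M \<noteq> {0}\<close> be a closed subspace that is invariant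
  under \<open>A\<close> and \<open>B\<close>. The tails of \<open>q x\<close> tend to 0, so \<open>B\<close> contracts some vector of \<open>M\<close>, and the
  infimum \<open>t\<close> of \<open>\<langle>T x, x\<rangle> = \<parallel>B x\<parallel>\<^sup>2\<close> on the unit sphere of \<open>M\<close> is less than 1. A minimising
  sequence consists of approximate eigenvectors of \<open>T\<close> for \<open>t\<close>. On such vectors
  \<open>\<parallel>B^k x\<parallel>\<^sup>2\<close> is close to \<open>t^k \<parallel>x\<parallel>\<^sup>2\<close>, which is small compared with \<open>\<parallel>x\<parallel>\<^sup>2\<close> for large \<open>k\<close>,
  so the norm is controlled by the first \<open>k\<close> levels, that is, by finitely many linear functionals.
  This is where \<open>G\<close> being finite matters: it gives a convergent subsequence
  (\<open>approximate_eigenvectors_convergent_subsequence\<close>), hence a nonzero eigenspace \<open>E\<close> of \<open>T\<close> in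
  \<open>M\<close>. The same compactness yields an eigenvector of the self-adjoint operator \<open>A + B\<close> in \<open>E\<close>, and a
  common eigenvector of \<open>A B\<close> and \<open>A + B\<close> is annihilated by a quadratic polynomial in \<open>A\<close>. So \<open>A\<close>
  has an eigenvector in \<open>M\<close> (\<open>reducing_subspace_has_eigenvector\<close>). Applied to the orthogonal
  complement of a maximal orthonormal set of eigenvectors this shows that such a set is complete.

  The eigenvalues. If \<open>A x = \<mu> x\<close>, then \<open>B x = cnj \<mu> x\<close>, and the shift identity with \<open>k = 1\<close> becomes
  \<open>(1 - \<bar>\<mu>\<bar>\<^sup>2) q x = (\<Sum>g\<in>G. \<bar>\<langle>x, g\<rangle>\<bar>\<^sup>2)\<close> (\<open>eigenvector_level_sum\<close>). The right-hand side is
  nonzero for \<open>x \<noteq> 0\<close>, so \<open>\<bar>\<mu>\<bar> < 1\<close>. More than \<open>|G|\<close> orthonormal eigenvectors for one \<open>\<mu>\<close> would have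
  a nonzero linear combination orthogonal to \<open>G\<close>, which is impossible; hence multiplicities are at
  most \<open>|G|\<close>. By the Bessel inequality, the right-hand sides have a finite sum over an orthonormal
  set of eigenvectors, so \<open>1 - \<bar>\<mu>\<bar>\<^sup>2\<close> is summable; hence the set is countable and the moduli tend to 1.

  Transport. The coefficients with respect to the eigenbasis give a unitary map onto the square-summable
  sequences that turns \<open>A\<close> into multiplication by its eigenvalue sequence. The \<open>P\<^sub>j\<close> are
  multiplications by the indicators of the level sets of that sequence.
\<close>

section \<open>Elementary geometry of complex inner product spaces\<close>

lemma cinner_add_right: "cinner x (y + z) = cinner x y + cinner x z"
  by (metis cinner_commute cinner_add_left complex_cnj_add)

lemma cinner_scaleC_right: "cinner x (c *\<^sub>C y) = cnj c * cinner x y"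
  by (metis cinner_commute cinner_scaleC_left complex_cnj_mult)

lemma cinner_scaleR_left: "cinner (r *\<^sub>R x) y = r *\<^sub>R cinner x y"
  by (simp add: scaleR_scaleC cinner_scaleC_left scaleR_conv_of_real)

lemma cinner_scaleR_right: "cinner x (r *\<^sub>R y) = r *\<^sub>R cinner x y"
  by (simp add: scaleR_scaleC cinner_scaleC_right scaleR_conv_of_real)

lemma cinner_zero_left [simp]: "cinner 0 x = 0"
  using cinner_add_left[of 0 0 x] by simp

lemma cinner_minus_left: "cinner (- x) y = - cinner x y"
  using cinner_add_left[of x "- x" y] by (simp add: add_eq_0_iff)

lemma cinner_diff_left: "cinner (x - y) z = cinner x z - cinner y z"
  using cinner_add_left[of x "- y" z] by (simp add: cinner_minus_left)

lemma norm_scaleC: "norm (c *\<^sub>C x) = cmod c * norm (x::'a::complex_inner)"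
proof -
  have "cinner (c *\<^sub>C x) (c *\<^sub>C x) = (c * cnj c) * cinner x x"
    by (simp add: cinner_scaleC_left cinner_scaleC_right)
  then have "complex_of_real ((norm (c *\<^sub>C x))\<^sup>2) = complex_of_real ((cmod c * norm x)\<^sup>2)"
    unfolding cinner_self complex_norm_square[symmetric] by (simp add: power_mult_distrib)
  then have "(norm (c *\<^sub>C x))\<^sup>2 = (cmod c * norm x)\<^sup>2"
    unfolding of_real_eq_iff .
  then show ?thesis by (simp add: power2_eq_iff_nonneg)
qed

lemma norm_cinner_le: "cmod (cinner x y) \<le> norm x * norm (y::'a::complex_inner)"
proof (cases "y = 0")
  case True
  have "cinner x 0 = 0" by (metis cinner_zero_left cinner_commute complex_cnj_zero)
  with True show ?thesis by simp
next
  case False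
  define c where "c = cinner x y / complex_of_real ((norm y)\<^sup>2)"
  have ny: "norm y > 0" using False by simp
  have "cinner (x - c *\<^sub>C y) y = 0"
    using False by (simp add: cinner_diff_left cinner_scaleC_left cinner_self c_def)
  then have "cinner x x = cinner (c *\<^sub>C y) (c *\<^sub>C y) + cinner (x - c *\<^sub>C y) (x - c *\<^sub>C y)"
    using cinner_add_left[of "x - c *\<^sub>C y" "c *\<^sub>C y" x]
      cinner_add_right[of "x - c *\<^sub>C y" "x - c *\<^sub>C y" "c *\<^sub>C y"]
      cinner_add_right[of "c *\<^sub>C y" "x - c *\<^sub>C y" "c *\<^sub>C y"]
      cinner_commute[of y "x - c *\<^sub>C y"]
    by (simp add: cinner_scaleC_left cinner_scaleC_right)
  then have "complex_of_real ((norm x)\<^sup>2)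
      = complex_of_real ((norm (c *\<^sub>C y))\<^sup>2 + (norm (x - c *\<^sub>C y))\<^sup>2)"
    unfolding cinner_self by simp
  then have "(norm x)\<^sup>2 = (norm (c *\<^sub>C y))\<^sup>2 + (norm (x - c *\<^sub>C y))\<^sup>2"
    unfolding of_real_eq_iff .
  then have "(norm (c *\<^sub>C y))\<^sup>2 \<le> (norm x)\<^sup>2" by simp
  then have "norm (c *\<^sub>C y) \<le> norm x" by (rule power2_le_imp_le) simp
  moreover have "norm (c *\<^sub>C y) = cmod (cinner x y) / norm y"
    using ny by (simp add: norm_scaleC c_def norm_divide power2_eq_square norm_mult)
  ultimately show ?thesis
    using ny by (simp add: field_simps)
qed

lemma bounded_bilinear_cinner:
  "bounded_bilinear (cinner :: 'a::complex_inner \<Rightarrow> 'a \<Rightarrow> complex)"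
  by standard (auto simp: cinner_add_left cinner_add_right cinner_scaleR_left
      cinner_scaleR_right intro!: exI[of _ 1] norm_cinner_le)

lemmas cinner_zero_right [simp] = bounded_bilinear.zero_right[OF bounded_bilinear_cinner]
  and cinner_diff_right = bounded_bilinear.diff_right[OF bounded_bilinear_cinner]
  and cinner_sum_left = bounded_bilinear.sum_left[OF bounded_bilinear_cinner]
  and cinner_sum_right = bounded_bilinear.sum_right[OF bounded_bilinear_cinner]
  and bounded_linear_cinner_left = bounded_bilinear.bounded_linear_left[OF bounded_bilinear_cinner]

lemma power2_norm_eq_Re_cinner: "(norm x)\<^sup>2 = Re (cinner x x)"
  by (simp add: cinner_self del: of_real_power)

lemma cinner_eq_zero_self [simp]: "cinner x x = 0 \<longleftrightarrow> x = 0"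
  by (simp add: cinner_self)

lemma cinner_eqI:
  assumes "\<And>z. cinner x z = cinner y z"
  shows "x = (y::'a::complex_inner)"
proof -
  have "cinner (x - y) (x - y) = 0"
    using assms[of "x - y"] by (simp only: cinner_diff_left diff_self)
  then show ?thesis by simp
qed

definition orthonormal :: "'a::complex_inner set \<Rightarrow> bool" where
  "orthonormal B \<longleftrightarrow> (\<forall>x\<in>B. norm x = 1) \<and> (\<forall>x\<in>B. \<forall>y\<in>B. x \<noteq> y \<longrightarrow> cinner x y = 0)"

lemma orthonormal_cinner:
  "orthonormal B \<Longrightarrow> x \<in> B \<Longrightarrow> y \<in> B \<Longrightarrow> cinner x y = (if x = y then 1 else 0)"
  by (auto simp: orthonormal_def cinner_self)

lemma power2_norm_orthonormal_sum:
  assumes "orthonormal B" "finite F" "F \<subseteq> B"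
  shows "(norm (\<Sum>e\<in>F. c e *\<^sub>C e))\<^sup>2 = (\<Sum>e\<in>F. (cmod (c e))\<^sup>2)"
proof -
  have "cinner (\<Sum>e\<in>F. c e *\<^sub>C e) (\<Sum>e\<in>F. c e *\<^sub>C e) =
      (\<Sum>e\<in>F. \<Sum>d\<in>F. if d = e then c e * cnj (c e) else 0)"
    unfolding cinner_sum_left cinner_sum_right
    using assms by (intro sum.cong refl)
      (auto simp: cinner_scaleC_left cinner_scaleC_right orthonormal_cinner[OF assms(1)] subset_eq)
  also have "\<dots> = complex_of_real (\<Sum>e\<in>F. (cmod (c e))\<^sup>2)"
    using assms(2) by (simp add: complex_norm_square del: of_real_power)
  finally show ?thesis
    unfolding cinner_self of_real_eq_iff .
qed

lemma bessel_finite: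
  assumes "orthonormal B" "finite F" "F \<subseteq> B"
  shows "(\<Sum>e\<in>F. (cmod (cinner x e))\<^sup>2) \<le> (norm x)\<^sup>2"
proof -
  define p where "p = (\<Sum>e\<in>F. cinner x e *\<^sub>C e)"
  have "cinner x p = complex_of_real (\<Sum>e\<in>F. (cmod (cinner x e))\<^sup>2)"
    by (simp add: p_def cinner_sum_right cinner_scaleC_right complex_norm_square
        mult.commute del: of_real_power)
  also have "\<dots> = cinner p p"
    unfolding cinner_self p_def power2_norm_orthonormal_sum[OF assms] ..
  finally have xp: "cinner x p = cinner p p" .
  then have px: "cinner p x = cinner p p"
    by (metis cinner_commute)
  have "(norm (x - p))\<^sup>2 = (norm x)\<^sup>2 - (norm p)\<^sup>2"
    by (simp add: power2_norm_eq_Re_cinner cinner_diff_left cinner_diff_right xp px)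
  then have "(norm p)\<^sup>2 \<le> (norm x)\<^sup>2"
    by (metis diff_ge_0_iff_ge zero_le_power2)
  then show ?thesis
    by (simp add: p_def power2_norm_orthonormal_sum[OF assms])
qed


section \<open>Normal operators\<close>

lemma bounded_clinearD:
  assumes "bounded_clinear T"
  shows "bounded_linear T" "T (c *\<^sub>C x) = c *\<^sub>C T x"
  using assms by (auto simp: bounded_clinear_def)

text \<open>
  The infimum \<open>h\<close> of a quadratic form on a unit sphere need not be attained, but a minimising
  sequence always consists of approximate eigenvectors: \<open>L = H - h\<close> is positive and so satisfies
  \<open>\<parallel>L x\<parallel>\<^sup>2 \<le> K \<langle>L x, x\<rangle>\<close>, where \<open>K\<close> is a bound for the norm of \<open>L\<close>.
\<close>

lemma approximate_lowest_eigenvectors: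
  fixes H :: "'a::complex_inner \<Rightarrow> 'a"
  assumes M: "complex_vector.subspace M" and x0: "x0 \<in> M" "x0 \<noteq> 0"
    and H: "bounded_clinear H" and inv: "H ` M \<subseteq> M"
    and selfadj: "\<And>x y. cinner (H x) y = cinner x (H y)"
  shows "\<exists>xs (h::real). (\<forall>n. xs n \<in> M \<and> norm (xs n) = 1) \<and>
    (\<forall>x\<in>M. h * (norm x)\<^sup>2 \<le> Re (cinner (H x) x)) \<and>
    (\<forall>k. (\<forall>x\<in>M. k * (norm x)\<^sup>2 \<le> Re (cinner (H x) x)) \<longrightarrow> k \<le> h) \<and>
    (\<lambda>n. H (xs n) - h *\<^sub>R xs n) \<longlonglongrightarrow> 0"
proof -
  interpret H: bounded_linear H by (rule bounded_clinearD(1)[OF H])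
  define V where "V = {Re (cinner (H x) x) |x. x \<in> M \<and> norm x = 1}"
  define h where "h = Inf V"
  have sgn: "(1 / norm x) *\<^sub>R x \<in> M" if "x \<in> M" for x
    using complex_vector.subspace_scale[OF M that] by (simp add: scaleR_scaleC)
  have ne: "V \<noteq> {}"
    using sgn[OF x0(1)] x0 by (force simp: V_def)
  obtain K0 where K0: "\<And>x. norm (H x) \<le> norm x * K0" "K0 > 0"
    using H.pos_bounded by blast
  have "\<bar>Re (cinner (H x) x)\<bar> \<le> K0" if "norm x = 1" for x
    using norm_cinner_le[of "H x" x] K0(1)[of x] that
      abs_Re_le_cmod[of "cinner (H x) x"] by simp
  then have bdd: "bdd_below V"
    unfolding bdd_below_def V_def
    by (intro exI[of _ "- K0"]) (force simp: abs_le_iff)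
  have scale: "Re (cinner (H (r *\<^sub>R x)) (r *\<^sub>R x)) = r\<^sup>2 * Re (cinner (H x) x)" for r x
    by (simp add: H.scaleR cinner_scaleR_left cinner_scaleR_right power2_eq_square)
  have lower: "h * (norm x)\<^sup>2 \<le> Re (cinner (H x) x)" if "x \<in> M" for x
  proof (cases "x = 0")
    case False
    have "Re (cinner (H ((1 / norm x) *\<^sub>R x)) ((1 / norm x) *\<^sub>R x)) \<in> V"
      using sgn[OF that] False by (auto simp: V_def)
    then have "h \<le> (1 / norm x)\<^sup>2 * Re (cinner (H x) x)"
      unfolding h_def scale using cInf_lower[OF _ bdd] by simp
    then show ?thesis
      using False by (simp add: field_simps)
  qed simp
  have greatest: "k \<le> h" if k: "\<And>x. x \<in> M \<Longrightarrow> k * (norm x)\<^sup>2 \<le> Re (cinner (H x) x)" for k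
    unfolding h_def
  proof (rule cInf_greatest[OF ne])
    fix v assume "v \<in> V"
    then show "k \<le> v" using k by (fastforce simp: V_def)
  qed
  have "\<exists>x. x \<in> M \<and> norm x = 1 \<and> Re (cinner (H x) x) < h + 1 / Suc n" for n
  proof -
    have "\<exists>v\<in>V. v < h + 1 / Suc n"
      using cInf_lessD[OF ne, of "h + 1 / Suc n"] by (auto simp: h_def)
    then show ?thesis by (auto simp: V_def)
  qed
  then obtain xs where xs: "\<And>n. xs n \<in> M" "\<And>n. norm (xs n) = 1"
      "\<And>n. Re (cinner (H (xs n)) (xs n)) < h + 1 / Suc n"
    by metis
  define L where "L x = H x - h *\<^sub>R x" for x
  have L_bl: "bounded_linear L"
    unfolding L_def by (intro bounded_linear_sub H.bounded_linear_axioms bounded_linear_scaleR_right)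
  then interpret L: bounded_linear L .
  obtain K where K: "\<And>x. norm (L x) \<le> norm x * K" "K > 0"
    using L.pos_bounded by blast
  have LM: "L x \<in> M" if "x \<in> M" for x
    unfolding L_def scaleR_scaleC
    by (intro complex_vector.subspace_diff[OF M] complex_vector.subspace_scale[OF M] imageI[THEN subsetD[OF inv]] that)
  have L_form: "Re (cinner (L x) x) = Re (cinner (H x) x) - h * (norm x)\<^sup>2" for x
    by (simp add: L_def cinner_diff_left cinner_scaleR_left power2_norm_eq_Re_cinner)
  have L_sa: "cinner (L x) y = cinner x (L y)" for x y
    by (simp add: L_def cinner_diff_left cinner_diff_right cinner_scaleR_left
        cinner_scaleR_right selfadj)
  \<comment> \<open>Positivity of the form at \<open>x - r (L x)\<close>, for the best step size \<open>r = 1 / K\<close>.\<close>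
  have L_norm: "(norm (L x))\<^sup>2 \<le> K * Re (cinner (L x) x)" if x: "x \<in> M" for x
  proof -
    define y where "y = L x"
    have "x - (1 / K) *\<^sub>R y \<in> M"
      unfolding y_def scaleR_scaleC
      by (intro complex_vector.subspace_diff[OF M] complex_vector.subspace_scale[OF M] x LM)
    then have "0 \<le> Re (cinner (L (x - (1 / K) *\<^sub>R y)) (x - (1 / K) *\<^sub>R y))"
      using lower by (simp add: L_form)
    also have "\<dots> = Re (cinner (L x) x) - (2 / K) * (norm y)\<^sup>2 + (1 / K)\<^sup>2 * Re (cinner (L y) y)"
      using L_sa[of y x] K(2)
      by (simp add: L.diff L.scaleR cinner_diff_left cinner_diff_right cinner_scaleR_left
          cinner_scaleR_right power2_norm_eq_Re_cinner y_def[symmetric])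
        (simp add: field_simps power2_eq_square)
    also have "Re (cinner (L y) y) \<le> K * (norm y)\<^sup>2"
    proof -
      have "Re (cinner (L y) y) \<le> norm (L y) * norm y"
        using complex_Re_le_cmod norm_cinner_le order_trans by blast
      also have "\<dots> \<le> (norm y * K) * norm y"
        by (intro mult_right_mono K) simp
      finally show ?thesis by (simp add: power2_eq_square mult_ac)
    qed
    finally have "0 \<le> Re (cinner (L x) x) - (2 / K) * (norm y)\<^sup>2 + (1 / K)\<^sup>2 * (K * (norm y)\<^sup>2)"
      by (simp add: mult_left_mono)
    also have "(1 / K)\<^sup>2 * (K * (norm y)\<^sup>2) = (1 / K) * (norm y)\<^sup>2"
      using K(2) by (simp add: power2_eq_square)
    finally show ?thesis
      using K(2) by (simp add: y_def field_simps)
  qed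
  have "(\<lambda>n. norm (L (xs n))) \<longlonglongrightarrow> 0"
  proof (rule tendsto_sandwich[where f = "\<lambda>_. 0" and h = "\<lambda>n. sqrt (K * (1 / Suc n))"])
    have "(norm (L (xs n)))\<^sup>2 \<le> K * (1 / Suc n)" for n
      using L_norm[OF xs(1)[of n]] xs(2,3)[of n] K(2)
      by (intro order_trans[OF L_norm[OF xs(1)[of n]]] mult_left_mono) (auto simp: L_form)
    then show "\<forall>\<^sub>F n in sequentially. norm (L (xs n)) \<le> sqrt (K * (1 / Suc n))"
      by (intro always_eventually allI real_le_rsqrt)
    have "(\<lambda>n. sqrt (K * (1 / Suc n))) \<longlonglongrightarrow> sqrt (K * 0)"
      using LIMSEQ_inverse_real_of_nat
      by (intro tendsto_intros) (simp add: inverse_eq_divide)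
    then show "(\<lambda>n. sqrt (K * (1 / Suc n))) \<longlonglongrightarrow> 0" by simp
  qed auto
  then have "(\<lambda>n. H (xs n) - h *\<^sub>R xs n) \<longlonglongrightarrow> 0"
    by (simp add: L_def tendsto_norm_zero_iff)
  with xs(1,2) lower greatest show ?thesis by blast
qed

locale normal_pair =
  fixes A B :: "'a::chilbert_space \<Rightarrow> 'a"
  assumes bounded: "bounded_clinear A"
    and adjoint: "cinner (A x) y = cinner x (B y)"
    and commute: "A (B x) = B (A x)"
begin

sublocale A: bounded_linear A
  by (rule bounded_clinearD(1)[OF bounded])

lemma A_scaleC: "A (c *\<^sub>C x) = c *\<^sub>C A x"
  by (rule bounded_clinearD(2)[OF bounded])

lemma adjoint': "cinner (B x) y = cinner x (A y)"
  by (metis adjoint cinner_commute)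

lemma norm_B: "norm (B x) = norm (A x)"
proof -
  have "cinner (B x) (B x) = cinner (A x) (A x)"
    by (metis adjoint adjoint' commute)
  then have "(norm (B x))\<^sup>2 = (norm (A x))\<^sup>2"
    by (simp add: power2_norm_eq_Re_cinner)
  then show ?thesis by (simp add: power2_eq_iff_nonneg)
qed

lemma B_scaleC: "B (c *\<^sub>C x) = c *\<^sub>C B x"
  by (rule cinner_eqI) (simp add: adjoint' cinner_scaleC_left)

lemma bounded_clinear_B: "bounded_clinear B"
proof -
  obtain K where K: "\<And>x. norm (A x) \<le> norm x * K"
    using A.bounded by blast
  have "bounded_linear B"
  proof (rule bounded_linear_intro[where K = K])
    show "B (x + y) = B x + B y" for x y
      by (rule cinner_eqI) (simp add: adjoint' cinner_add_left)
    show "B (r *\<^sub>R x) = r *\<^sub>R B x" for r x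
      by (simp add: scaleR_scaleC B_scaleC)
    show "norm (B x) \<le> norm x * K" for x
      by (simp add: norm_B K)
  qed
  then show ?thesis by (simp add: bounded_clinear_def B_scaleC)
qed

sublocale B: bounded_linear B
  by (rule bounded_clinearD(1)[OF bounded_clinear_B])

lemma adjoint_power: "cinner ((B ^^ n) x) y = cinner x ((A ^^ n) y)"
  by (induction n arbitrary: x) (simp_all add: adjoint' funpow_swap1)

lemma eigenvector_adjoint:
  assumes "A x = \<mu> *\<^sub>C x"
  shows "B x = cnj \<mu> *\<^sub>C x"
proof -
  have AB: "A (B x) = \<mu> *\<^sub>C B x"
    by (simp add: commute assms B_scaleC)
  have 1: "cinner (B x) (B x) = \<mu> * cinner (B x) x" 
    by (metis AB adjoint' cinner_commute cinner_scaleC_left adjoint)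
  have 2: "cinner (B x) x = cnj \<mu> * cinner x x"
    by (simp add: adjoint' assms cinner_scaleC_right)
  have 3: "cinner x (B x) = \<mu> * cinner x x"
    by (simp add: adjoint[symmetric] assms cinner_scaleC_left)
  have "cinner (B x - cnj \<mu> *\<^sub>C x) (B x - cnj \<mu> *\<^sub>C x) = 0"
    by (simp add: cinner_diff_left cinner_diff_right cinner_scaleC_left cinner_scaleC_right 1 2 3)
  then show ?thesis by simp
qed

text \<open>
  Since \<open>A\<close> and \<open>B\<close> commute, \<open>T\<close> commutes with both, so its eigenspaces reduce \<open>A\<close>; its powers
  measure the iterates of \<open>B\<close>.
\<close>

definition T :: "'a \<Rightarrow> 'a" where "T x = A (B x)"

lemma bounded_clinear_T: "bounded_clinear T"
  unfolding bounded_clinear_def T_def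
  by (auto simp: A_scaleC B_scaleC
      intro: bounded_linear_compose[OF A.bounded_linear_axioms B.bounded_linear_axioms])

sublocale T: bounded_linear T
  by (rule bounded_clinearD(1)[OF bounded_clinear_T])

lemma T_scaleC: "T (c *\<^sub>C x) = c *\<^sub>C T x"
  by (rule bounded_clinearD(2)[OF bounded_clinear_T])

lemma T_selfadjoint: "cinner (T x) y = cinner x (T y)"
  by (simp add: T_def adjoint adjoint' commute)

lemma T_commute: "T (A x) = A (T x)" "T (B x) = B (T x)"
  by (simp_all add: T_def commute)

lemma T_power_commute: "(T ^^ n) (A x) = A ((T ^^ n) x)"
  by (induction n) (simp_all add: T_commute)

lemma T_power_form: "cinner ((T ^^ n) x) x = complex_of_real ((norm ((B ^^ n) x))\<^sup>2)"
proof (induction n arbitrary: x)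
  case (Suc n)
  have "cinner ((T ^^ Suc n) x) x = cinner (A ((T ^^ n) (B x))) x"
    by (simp add: funpow_Suc_right T_def[of x] T_power_commute del: funpow.simps)
  also have "\<dots> = cinner ((T ^^ n) (B x)) (B x)"
    by (rule adjoint)
  also have "\<dots> = complex_of_real ((norm ((B ^^ Suc n) x))\<^sup>2)"
    by (simp add: Suc.IH funpow_swap1)
  finally show ?case .
qed (simp add: cinner_self)

end


section \<open>Homogeneous linear systems\<close>

text \<open>
  Gaussian elimination: an equation with a nonzero coefficient at the unknown \<open>k\<close> is solved for it,
  which leaves a system with one equation and one unknown fewer.
\<close>

lemma underdetermined_system:
  fixes a :: "'i \<Rightarrow> 'g \<Rightarrow> complex"
  assumes "finite G" "finite I" "card G < card I"
  shows "\<exists>c. (\<exists>i\<in>I. c i \<noteq> 0) \<and> (\<forall>g\<in>G. (\<Sum>i\<in>I. c i * a i g) = 0)"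
  using assms
proof (induction G arbitrary: I a rule: finite_induct)
  case empty
  then have "I \<noteq> {}" by auto
  then show ?case by (intro exI[of _ "\<lambda>_. 1"]) auto
next
  case (insert g G)
  show ?case
  proof (cases "\<forall>i\<in>I. a i g = 0")
    case True
    have "card G < card I" using insert.prems insert.hyps by simp
    then obtain c where "\<exists>i\<in>I. c i \<noteq> 0" "\<forall>h\<in>G. (\<Sum>i\<in>I. c i * a i h) = 0"
      using insert.IH[OF insert.prems(1)] by blast
    then show ?thesis using True by (intro exI[of _ c]) auto
  next
    case False
    then obtain k where k: "k \<in> I" "a k g \<noteq> 0" by blast
    have "card G < card (I - {k})"
      using insert.prems insert.hyps k(1) by simp
    then obtain c where c: "\<exists>i\<in>I - {k}. c i \<noteq> 0"
      "\<forall>h\<in>G. (\<Sum>i\<in>I - {k}. c i * (a i h - a i g / a k g * a k h)) = 0"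
      using insert.IH[of "I - {k}" "\<lambda>i h. a i h - a i g / a k g * a k h"] insert.prems(1) by auto
    define s where "s = (\<Sum>i\<in>I - {k}. c i * a i g) / a k g"
    define c' where "c' i = (if i = k then - s else c i)" for i
    have sum: "(\<Sum>i\<in>I. c' i * a i h) = (\<Sum>i\<in>I - {k}. c i * a i h) - s * a k h" for h
      using k(1) insert.prems(1) by (simp add: sum.remove c'_def)
    have "(\<Sum>i\<in>I. c' i * a i h) = 0" if "h \<in> insert g G" for h
    proof (cases "h = g")
      case True
      then show ?thesis using k(2) by (simp only: sum) (simp add: s_def)
    next
      case False
      then have "0 = (\<Sum>i\<in>I - {k}. c i * (a i h - a i g / a k g * a k h))"
        using that c(2) by simp
      also have "\<dots> = (\<Sum>i\<in>I - {k}. c i * a i h) - s * a k h"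
        by (simp add: s_def right_diff_distrib sum_subtractf sum_distrib_right
            sum_divide_distrib mult.assoc)
      finally show ?thesis by (simp only: sum)
    qed
    moreover have "\<exists>i\<in>I. c' i \<noteq> 0" using c(1) by (auto simp: c'_def)
    ultimately show ?thesis by blast
  qed
qed

section \<open>Frames of iterates\<close>

definition level_sum :: "('a::complex_inner \<Rightarrow> 'a) \<Rightarrow> 'a set \<Rightarrow> 'a \<Rightarrow> nat \<Rightarrow> real" where
  "level_sum A G x n = (\<Sum>g\<in>G. (cmod (cinner x ((A ^^ n) g)))\<^sup>2)"

lemma level_sum_nonneg: "0 \<le> level_sum A G x n"
  by (simp add: level_sum_def sum_nonneg)

text \<open>
  Summing over \<open>G\<close> first turns the frame condition into one about ordinary series in \<open>n\<close>, whose terms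
  the adjoint shifts.
\<close>

lemma is_frame_level_sums:
  assumes fin: "finite G" and frame: "is_frame (G \<times> (UNIV :: nat set)) (\<lambda>(g, n). (A ^^ n) g)"
  obtains c1 c2 where "0 < c1" "\<And>x. summable (level_sum A G x)"
    "\<And>x. c1 * (norm x)\<^sup>2 \<le> suminf (level_sum A G x)"
    "\<And>x. suminf (level_sum A G x) \<le> c2 * (norm x)\<^sup>2"
proof -
  obtain c1 c2 where c: "0 < c1"
    "\<And>x. (\<lambda>i. (cmod (cinner x (case i of (g, n) \<Rightarrow> (A ^^ n) g)))\<^sup>2) summable_on G \<times> UNIV"
    "\<And>x. c1 * (norm x)\<^sup>2
        \<le> (\<Sum>\<^sub>\<infinity>i\<in>G \<times> UNIV. (cmod (cinner x (case i of (g, n) \<Rightarrow> (A ^^ n) g)))\<^sup>2)"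
    "\<And>x. (\<Sum>\<^sub>\<infinity>i\<in>G \<times> UNIV. (cmod (cinner x (case i of (g, n) \<Rightarrow> (A ^^ n) g)))\<^sup>2)
        \<le> c2 * (norm x)\<^sup>2"
    using frame unfolding is_frame_def by blast
  have sums: "level_sum A G x sums
      (\<Sum>\<^sub>\<infinity>i\<in>G \<times> UNIV. (cmod (cinner x (case i of (g, n) \<Rightarrow> (A ^^ n) g)))\<^sup>2)" for x
  proof (rule has_sum_imp_sums, rule has_sum_SigmaD)
    let ?f = "\<lambda>i. (cmod (cinner x (case i of (g, n) \<Rightarrow> (A ^^ n) g)))\<^sup>2"
    show "((\<lambda>(n, g). ?f (g, n)) has_sum infsum ?f (G \<times> UNIV)) (UNIV \<times> G)"
      using has_sum_infsum[OF c(2)[of x]]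
      by (subst has_sum_swap) (simp add: case_prod_unfold)
    show "((\<lambda>g. (\<lambda>(n, g). ?f (g, n)) (n, g)) has_sum level_sum A G x n) G" for n
      using fin by (intro has_sum_finiteI) (auto simp: level_sum_def)
  qed
  show thesis
    using that[of c1 c2] c(1,3,4) sums by (simp add: sums_iff)
qed

locale normal_frame = normal_pair A B for A B :: "'a::chilbert_space \<Rightarrow> 'a" +
  fixes G :: "'a set" and c1 c2 :: real
  assumes finite_G: "finite G" and c1_pos: "0 < c1"
    and summable_level: "summable (level_sum A G x)"
    and lower: "c1 * (norm x)\<^sup>2 \<le> suminf (level_sum A G x)"
    and upper: "suminf (level_sum A G x) \<le> c2 * (norm x)\<^sup>2"
begin

abbreviation w :: "'a \<Rightarrow> nat \<Rightarrow> real" where "w \<equiv> level_sum A G"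

lemma level_sum_B_power: "w ((B ^^ k) x) = (\<lambda>n. w x (n + k))"
proof
  fix n
  have "cinner ((B ^^ k) x) ((A ^^ n) g) = cinner x ((A ^^ (n + k)) g)" for g
    by (simp add: adjoint_power add.commute[of n] funpow_add)
  then show "w ((B ^^ k) x) n = w x (n + k)" by (simp add: level_sum_def)
qed

text \<open>
  Vectors that \<open>B^k\<close> makes small are controlled by the finitely many functionals of the first \<open>k\<close>
  levels. All compactness below comes from this inequality.
\<close>

lemma frame_truncation:
  "c1 * (norm x)\<^sup>2 \<le> c2 * (norm ((B ^^ k) x))\<^sup>2 + (\<Sum>i<k. w x i)"
proof -
  have "c1 * (norm x)\<^sup>2 \<le> (\<Sum>n. w x (n + k)) + (\<Sum>i<k. w x i)"
    using lower[of x] suminf_split_initial_segment[OF summable_level, of x k] by simp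
  also have "(\<Sum>n. w x (n + k)) = suminf (w ((B ^^ k) x))"
    by (simp add: level_sum_B_power)
  finally show ?thesis using upper[of "(B ^^ k) x"] by linarith
qed

text \<open>
  The form at \<open>B^n x\<close> is a tail of a convergent series, so \<open>B^n x\<close> tends to 0, which is incompatible
  with norms that never decrease.
\<close>

lemma B_not_expansive:
  assumes M: "\<And>x. x \<in> M \<Longrightarrow> B x \<in> M" and x: "x \<in> M" "x \<noteq> 0"
  shows "\<exists>y\<in>M. norm (B y) < norm y"
proof (rule ccontr)
  assume "\<not> ?thesis"
  then have exp: "norm y \<le> norm (B y)" if "y \<in> M" for y
    using that by (meson not_less)
  have pow: "(B ^^ n) x \<in> M \<and> norm x \<le> norm ((B ^^ n) x)" for n
  proof (induction n)
    case (Suc n)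
    then show ?case using exp[of "(B ^^ n) x"] M by auto
  qed (simp add: x)
  have "0 < c1 * (norm x)\<^sup>2" using c1_pos x by simp
  then obtain n where n: "norm (\<Sum>i. w x (i + n)) < c1 * (norm x)\<^sup>2"
    using suminf_exist_split[OF _ summable_level] by blast
  have "c1 * (norm x)\<^sup>2 \<le> c1 * (norm ((B ^^ n) x))\<^sup>2"
    using pow[of n] c1_pos by (intro mult_left_mono power_mono) auto
  also have "\<dots> \<le> (\<Sum>i. w x (i + n))"
    using lower[of "(B ^^ n) x"] by (simp add: level_sum_B_power)
  finally show False using n by simp
qed

text \<open>
  Compactness below the value 1. By \<open>frame_truncation\<close> with \<open>K\<close> so large that \<open>c2 t^K < c1 / 2\<close>, the
  norm of a difference of two approximate eigenvectors is dominated by its values under finitely many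
  functionals, up to an error that vanishes. A subsequence on which these functionals converge is
  therefore Cauchy.
\<close>

lemma approximate_eigenvectors_convergent_subsequence:
  assumes t: "0 \<le> t" "t < 1" and xs: "\<And>n. norm (xs n) = 1"
    and lim: "(\<lambda>n. T (xs n) - t *\<^sub>R xs n) \<longlonglongrightarrow> 0"
  obtains r l where "strict_mono r" "(xs \<circ> r) \<longlonglongrightarrow> l"
proof -
  have "0 \<le> c2"
    using lower[of "xs 0"] upper[of "xs 0"] c1_pos xs[of 0] by simp
  have "(\<lambda>k. c2 * t ^ k) \<longlonglongrightarrow> c2 * 0"
    using t by (intro tendsto_intros LIMSEQ_power_zero) simp
  then have "\<forall>\<^sub>F k in sequentially. c2 * t ^ k < c1 / 2"
    using c1_pos by (intro order_tendstoD(2)[of _ 0]) auto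
  then obtain K where K: "c2 * t ^ K < c1 / 2"
    by (auto simp: eventually_sequentially)
  \<comment> \<open>Approximate eigenvectors of \<open>T\<close> for \<open>t\<close> are approximate eigenvectors of \<open>T^K\<close> for \<open>t^K\<close>.\<close>
  define D where "D n = (T ^^ K) (xs n) - t ^ K *\<^sub>R xs n" for n
  have "(\<lambda>n. (T ^^ k) (xs n) - t ^ k *\<^sub>R xs n) \<longlonglongrightarrow> 0" for k
  proof (induction k)
    case (Suc k)
    have "(\<lambda>n. T ((T ^^ k) (xs n) - t ^ k *\<^sub>R xs n) + t ^ k *\<^sub>R (T (xs n) - t *\<^sub>R xs n))
        \<longlonglongrightarrow> T 0 + t ^ k *\<^sub>R 0"
      by (intro tendsto_intros T.tendsto Suc lim)
    then show ?case
      by (simp add: T.diff T.scaleR T.zero scaleR_diff_right mult.commute)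
  qed simp
  then have D_lim: "D \<longlonglongrightarrow> 0" by (simp add: D_def[abs_def])
  have bounded_coeff: "cmod (cinner (xs n) ((A ^^ fst p) (snd p)))
      \<le> (MAX p \<in> {..<K} \<times> G. norm ((A ^^ fst p) (snd p)))" if "p \<in> {..<K} \<times> G" for n p
  proof -
    have "cmod (cinner (xs n) ((A ^^ fst p) (snd p))) \<le> norm ((A ^^ fst p) (snd p))"
      using norm_cinner_le[of "xs n" "(A ^^ fst p) (snd p)"] by (simp add: xs)
    also have "\<dots> \<le> (MAX p \<in> {..<K} \<times> G. norm ((A ^^ fst p) (snd p)))"
      using finite_G that by (intro Max_ge) auto
    finally show ?thesis .
  qed
  have "countable ({..<K} \<times> G)"
    using finite_G by (intro countable_finite) auto
  then have "\<exists>r. strict_mono r \<and> (\<forall>p \<in> {..<K} \<times> G.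
      \<exists>l. (\<lambda>n. cinner (xs (r n)) ((A ^^ fst p) (snd p))) \<longlonglongrightarrow> l)"
    by (rule function_convergent_subsequence[where
        f = "\<lambda>n p. cinner (xs n) ((A ^^ fst p) (snd p))", OF _ bounded_coeff]) blast+
  then obtain r where r: "strict_mono r" and conv: "\<forall>p \<in> {..<K} \<times> G.
      \<exists>l. (\<lambda>n. cinner (xs (r n)) ((A ^^ fst p) (snd p))) \<longlonglongrightarrow> l"
    by (elim exE conjE)
  define c where "c p = lim (\<lambda>n. cinner (xs (r n)) ((A ^^ fst p) (snd p)))" for p
  have c: "(\<lambda>n. cinner (xs (r n)) ((A ^^ i) g)) \<longlonglongrightarrow> c (i, g)" if "i < K" "g \<in> G" for i g
    using bspec[OF conv, of "(i, g)"] that convergent_LIMSEQ_iff[of "\<lambda>n. cinner (xs (r n)) ((A ^^ i) g)"]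
    by (simp add: c_def convergent_def)
  \<comment> \<open>This double sequence bounds the squared distances in the subsequence; \<open>2\<close> is a bound for the
    norm of a difference of two unit vectors.\<close>
  define \<epsilon> where "\<epsilon> p = 2 * c2 * norm (D (r (fst p)) - D (r (snd p)))
      + (\<Sum>i<K. w (xs (r (fst p)) - xs (r (snd p))) i)" for p
  have bound: "c1 / 2 * (norm (xs m - xs n))\<^sup>2
      \<le> 2 * c2 * norm (D m - D n) + (\<Sum>i<K. w (xs m - xs n) i)" for m n
  proof -
    define y where "y = xs m - xs n"
    have T_power_diff: "(T ^^ k) (u - v) = (T ^^ k) u - (T ^^ k) v" for k u v
      by (induction k) (simp_all add: T.diff)
    have Ty: "(T ^^ K) y = t ^ K *\<^sub>R y + (D m - D n)"
      by (simp add: D_def y_def T_power_diff algebra_simps)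
    have y2: "norm y \<le> 2"
      unfolding y_def using norm_triangle_ineq4[of "xs m" "xs n"] by (simp add: xs)
    have "(norm ((B ^^ K) y))\<^sup>2 = Re (cinner ((T ^^ K) y) y)"
      by (simp add: T_power_form del: of_real_power)
    also have "\<dots> = t ^ K * (norm y)\<^sup>2 + Re (cinner (D m - D n) y)"
      by (simp add: Ty cinner_add_left cinner_scaleR_left power2_norm_eq_Re_cinner)
    also have "Re (cinner (D m - D n) y) \<le> norm (D m - D n) * norm y"
      using complex_Re_le_cmod norm_cinner_le order_trans by blast
    also have "\<dots> \<le> norm (D m - D n) * 2"
      using y2 by (intro mult_left_mono) auto
    finally have "c2 * (norm ((B ^^ K) y))\<^sup>2 \<le> c2 * (t ^ K * (norm y)\<^sup>2 + norm (D m - D n) * 2)"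
      using \<open>0 \<le> c2\<close> by (intro mult_left_mono) auto
    moreover have "c2 * t ^ K * (norm y)\<^sup>2 \<le> c1 / 2 * (norm y)\<^sup>2"
      using K by (intro mult_right_mono) auto
    ultimately show ?thesis
      using frame_truncation[of y K] by (simp add: y_def[symmetric] algebra_simps)
  qed
  have fst_lim: "((\<lambda>p. f (fst p)) \<longlongrightarrow> l) (sequentially \<times>\<^sub>F sequentially)"
    and snd_lim: "((\<lambda>p. f (snd p)) \<longlongrightarrow> l) (sequentially \<times>\<^sub>F sequentially)"
    if "f \<longlonglongrightarrow> l" for f :: "nat \<Rightarrow> 'b::topological_space" and l
    by (rule filterlim_compose[OF that filterlim_fst], rule filterlim_compose[OF that filterlim_snd])
  have Dr_lim: "(\<lambda>n. D (r n)) \<longlonglongrightarrow> 0"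
    using LIMSEQ_subseq_LIMSEQ[OF D_lim r] by (simp add: o_def)
  have c_lim: "((\<lambda>p. (cmod (cinner (xs (r (fst p))) ((A ^^ i) g)
        - cinner (xs (r (snd p))) ((A ^^ i) g)))\<^sup>2) \<longlongrightarrow> (cmod (c (i, g) - c (i, g)))\<^sup>2)
      (sequentially \<times>\<^sub>F sequentially)" if "i < K" "g \<in> G" for i g
    by (rule tendsto_power tendsto_norm tendsto_diff fst_lim[OF c[OF that]]
        snd_lim[OF c[OF that]])+
  have "((\<lambda>p. \<Sum>i<K. w (xs (r (fst p)) - xs (r (snd p))) i) \<longlongrightarrow>
      (\<Sum>i<K. \<Sum>g\<in>G. (cmod (c (i, g) - c (i, g)))\<^sup>2)) (sequentially \<times>\<^sub>F sequentially)"
    unfolding level_sum_def cinner_diff_left by (intro tendsto_sum c_lim) auto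
  moreover have "((\<lambda>p. 2 * c2 * norm (D (r (fst p)) - D (r (snd p)))) \<longlongrightarrow>
      2 * c2 * norm (0 - 0 :: 'a)) (sequentially \<times>\<^sub>F sequentially)"
    by (rule tendsto_mult tendsto_const tendsto_norm tendsto_diff fst_lim[OF Dr_lim]
        snd_lim[OF Dr_lim])+
  ultimately have "(\<epsilon> \<longlongrightarrow> 2 * c2 * norm (0 - 0 :: 'a)
      + (\<Sum>i<K. \<Sum>g\<in>G. (cmod (c (i, g) - c (i, g)))\<^sup>2)) (sequentially \<times>\<^sub>F sequentially)"
    unfolding \<epsilon>_def[abs_def] by (intro tendsto_add)
  then have \<epsilon>_lim: "(\<epsilon> \<longlongrightarrow> 0) (sequentially \<times>\<^sub>F sequentially)" by simp
  have "Cauchy (xs \<circ> r)"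
  proof (rule metric_CauchyI)
    fix e :: real assume e: "0 < e"
    then have "\<forall>\<^sub>F p in sequentially \<times>\<^sub>F sequentially. \<epsilon> p < c1 / 2 * e\<^sup>2"
      using c1_pos by (intro order_tendstoD(2)[OF \<epsilon>_lim]) simp
    then have "\<exists>N. \<forall>m\<ge>N. \<forall>n\<ge>N. \<epsilon> (n, m) < c1 / 2 * e\<^sup>2"
      by (simp only: eventually_prod_sequentially)
    then obtain N where N: "\<forall>m\<ge>N. \<forall>n\<ge>N. \<epsilon> (n, m) < c1 / 2 * e\<^sup>2" ..
    have "dist ((xs \<circ> r) m) ((xs \<circ> r) n) < e" if "m \<ge> N" "n \<ge> N" for m n
    proof -
      have "c1 / 2 * (norm (xs (r m) - xs (r n)))\<^sup>2 < c1 / 2 * e\<^sup>2"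
        using bound[of "r m" "r n"] N[rule_format, OF that(2,1)] by (simp add: \<epsilon>_def)
      then have "(norm (xs (r m) - xs (r n)))\<^sup>2 < e\<^sup>2"
        using c1_pos by simp
      then have "norm (xs (r m) - xs (r n)) < e"
        using e by (rule power2_less_imp_less[OF _ less_imp_le])
      then show ?thesis by (simp add: dist_norm)
    qed
    then show "\<exists>N. \<forall>m\<ge>N. \<forall>n\<ge>N. dist ((xs \<circ> r) m) ((xs \<circ> r) n) < e" by blast
  qed
  then obtain l where "(xs \<circ> r) \<longlonglongrightarrow> l"
    using Cauchy_convergent[of "xs \<circ> r"] by (auto simp: convergent_def)
  with r show thesis by (rule that)
qed

text \<open>
  Two minimisations, first of \<open>\<parallel>B x\<parallel>\<^sup>2\<close> on \<open>M\<close> and then of \<open>\<langle>(A + B) x, x\<rangle>\<close> on the eigenspace found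
  first, produce \<open>v\<close> with \<open>A B v = t v\<close> and \<open>(A + B) v = a v\<close>. Eliminating \<open>B\<close> gives
  \<open>A\<^sup>2 v - a A v + t v = 0\<close>, and a factorisation of this quadratic polynomial yields an eigenvector.
\<close>

lemma reducing_subspace_has_eigenvector:
  assumes M: "complex_vector.subspace M" "closed M"
    and inv: "\<And>x. x \<in> M \<Longrightarrow> A x \<in> M" "\<And>x. x \<in> M \<Longrightarrow> B x \<in> M"
    and x0: "x0 \<in> M" "x0 \<noteq> 0"
  obtains x \<mu> where "x \<in> M" "norm x = 1" "A x = \<mu> *\<^sub>C x"
proof -
  have T_inv: "T ` M \<subseteq> M"
    using inv by (auto simp: T_def)
  have T_form: "Re (cinner (T x) x) = (norm (B x))\<^sup>2" for x
    using T_power_form[of 1 x] by (simp del: of_real_power)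
  obtain us and t :: real where us: "\<forall>n. us n \<in> M \<and> norm (us n) = 1"
    and t: "\<forall>x\<in>M. t * (norm x)\<^sup>2 \<le> Re (cinner (T x) x)"
      "\<forall>k. (\<forall>x\<in>M. k * (norm x)\<^sup>2 \<le> Re (cinner (T x) x)) \<longrightarrow> k \<le> t"
    and us_lim: "(\<lambda>n. T (us n) - t *\<^sub>R us n) \<longlonglongrightarrow> 0"
    using approximate_lowest_eigenvectors[OF M(1) x0 bounded_clinear_T T_inv T_selfadjoint]
    by (elim exE conjE)
  have "0 \<le> t" using t(2) by (simp add: T_form)
  \<comment> \<open>The compactness lemma is available only because the minimum lies strictly below 1.\<close>
  have "t < 1"
  proof -
    obtain y where y: "y \<in> M" "norm (B y) < norm y"
      using B_not_expansive[OF inv(2) x0] by blast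
    have "t * (norm y)\<^sup>2 \<le> (norm (B y))\<^sup>2" using t(1) y(1) by (fastforce simp: T_form)
    also have "\<dots> < (norm y)\<^sup>2" using y(2) by (intro power_strict_mono) auto
    finally have "t * (norm y)\<^sup>2 < 1 * (norm y)\<^sup>2" by simp
    then show ?thesis by (rule mult_right_less_imp_less) simp
  qed
  obtain r u where r: "strict_mono r" and u: "(us \<circ> r) \<longlonglongrightarrow> u"
    using approximate_eigenvectors_convergent_subsequence[OF \<open>0 \<le> t\<close> \<open>t < 1\<close> _ us_lim] us by blast
  define E where "E = {x \<in> M. T x = t *\<^sub>R x}"
  have "u \<in> M"
    using closed_sequentially[OF M(2) _ u] us by simp
  moreover have "T u - t *\<^sub>R u = 0"
  proof (rule LIMSEQ_unique)
    show "(\<lambda>n. T ((us \<circ> r) n) - t *\<^sub>R (us \<circ> r) n) \<longlonglongrightarrow> T u - t *\<^sub>R u"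
      by (intro tendsto_intros T.tendsto u)
    show "(\<lambda>n. T ((us \<circ> r) n) - t *\<^sub>R (us \<circ> r) n) \<longlonglongrightarrow> 0"
      using LIMSEQ_subseq_LIMSEQ[OF us_lim r] by (simp add: o_def)
  qed
  ultimately have uE: "u \<in> E" by (simp add: E_def)
  have "norm u = 1"
    using tendsto_norm[OF u] by (simp add: us LIMSEQ_const_iff)
  then have "u \<noteq> 0" by auto
  have E: "complex_vector.subspace E"
    unfolding E_def complex_vector.subspace_def
    using M(1) by (auto simp: complex_vector.subspace_0 complex_vector.subspace_add
        complex_vector.subspace_scale T.add T.zero T_scaleC scaleR_add_right
        scaleR_scaleC scaleC_scaleC scaleC_add_right mult.commute)
  define H where "H x = A x + B x" for x
  have H: "bounded_clinear H"
    unfolding bounded_clinear_def H_def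
    by (auto simp: A_scaleC B_scaleC scaleC_add_right
        intro: bounded_linear_add A.bounded_linear_axioms B.bounded_linear_axioms)
  then interpret H: bounded_linear H by (rule bounded_clinearD)
  have EH: "H ` E \<subseteq> E"
  proof (rule image_subsetI)
    fix x assume that: "x \<in> E"
    have "A x + B x \<in> M" using that M(1) inv by (auto simp: E_def complex_vector.subspace_add)
    moreover have "T (A x + B x) = t *\<^sub>R (A x + B x)"
      using that by (simp add: T.add T_commute E_def A.scaleR B.scaleR scaleR_add_right)
    ultimately show "H x \<in> E" by (simp add: E_def H_def)
  qed
  have H_sa: "cinner (H x) y = cinner x (H y)" for x y
    by (simp add: H_def cinner_add_left cinner_add_right adjoint adjoint' add.commute)
  obtain vs and a :: real where vs: "\<forall>n. vs n \<in> E \<and> norm (vs n) = 1"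
    and vs_lim: "(\<lambda>n. H (vs n) - a *\<^sub>R vs n) \<longlonglongrightarrow> 0"
    using approximate_lowest_eigenvectors[OF E uE \<open>u \<noteq> 0\<close> H EH H_sa]
    by (elim exE conjE)
  have "(\<lambda>n. T (vs n) - t *\<^sub>R vs n) \<longlonglongrightarrow> 0"
    using vs by (simp add: E_def)
  from approximate_eigenvectors_convergent_subsequence[OF \<open>0 \<le> t\<close> \<open>t < 1\<close> _ this]
  obtain s v where s: "strict_mono s" and v: "(vs \<circ> s) \<longlonglongrightarrow> v"
    using vs by blast
  have vM: "v \<in> M"
    using closed_sequentially[OF M(2) _ v] vs by (simp add: E_def)
  have "norm v = 1"
    using tendsto_norm[OF v] by (simp add: vs LIMSEQ_const_iff)
  then have "v \<noteq> 0" by auto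
  have "T v - t *\<^sub>R v = 0"
  proof (rule LIMSEQ_unique)
    show "(\<lambda>n. T ((vs \<circ> s) n) - t *\<^sub>R (vs \<circ> s) n) \<longlonglongrightarrow> T v - t *\<^sub>R v"
      by (intro tendsto_intros T.tendsto v)
    show "(\<lambda>n. T ((vs \<circ> s) n) - t *\<^sub>R (vs \<circ> s) n) \<longlonglongrightarrow> 0"
      using vs by (simp add: E_def)
  qed
  then have Tv: "A (B v) = complex_of_real t *\<^sub>C v" by (simp add: T_def scaleR_scaleC)
  have "H v - a *\<^sub>R v = 0"
  proof (rule LIMSEQ_unique)
    show "(\<lambda>n. H ((vs \<circ> s) n) - a *\<^sub>R (vs \<circ> s) n) \<longlonglongrightarrow> H v - a *\<^sub>R v"
      by (intro tendsto_intros H.tendsto v)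
    show "(\<lambda>n. H ((vs \<circ> s) n) - a *\<^sub>R (vs \<circ> s) n) \<longlonglongrightarrow> 0"
      using LIMSEQ_subseq_LIMSEQ[OF vs_lim s] by (simp add: o_def)
  qed
  then have "B v = complex_of_real a *\<^sub>C v - A v"
    by (simp add: H_def scaleR_scaleC algebra_simps)
  then have "A (complex_of_real a *\<^sub>C v - A v) = complex_of_real t *\<^sub>C v"
    using Tv by simp
  then have quad: "A (A v) = complex_of_real a *\<^sub>C A v - complex_of_real t *\<^sub>C v"
    by (simp add: A.diff A_scaleC algebra_simps)
  \<comment> \<open>\<open>\<alpha>\<close> and \<open>\<beta>\<close> are the roots of \<open>z\<^sup>2 - a z + t\<close>, so \<open>(A - \<alpha>) (A - \<beta>) v = 0\<close>: either \<open>v\<close> or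
    \<open>(A - \<beta>) v\<close> is an eigenvector.\<close>
  define d where "d = csqrt ((complex_of_real a)\<^sup>2 - 4 * complex_of_real t)"
  define \<alpha> \<beta> where "\<alpha> = (complex_of_real a + d) / 2" and "\<beta> = (complex_of_real a - d) / 2"
  have sum: "complex_of_real a = \<alpha> + \<beta>" by (simp add: \<alpha>_def \<beta>_def field_simps)
  have "\<alpha> * \<beta> = ((complex_of_real a)\<^sup>2 - d\<^sup>2) / 4"
    by (simp add: \<alpha>_def \<beta>_def power2_eq_square field_simps)
  then have prod: "complex_of_real t = \<alpha> * \<beta>" by (simp add: d_def)
  define z where "z = A v - \<beta> *\<^sub>C v"
  have "z \<in> M"
    unfolding z_def by (intro complex_vector.subspace_diff[OF M(1)]
        complex_vector.subspace_scale[OF M(1)] inv vM)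
  have Az: "A z = \<alpha> *\<^sub>C z"
    by (simp add: z_def A.diff A_scaleC quad sum prod scaleC_add_left scaleC_scaleC
        complex_vector.scale_right_diff_distrib)
  show thesis
  proof (cases "z = 0")
    case True
    then have "A v = \<beta> *\<^sub>C v" by (simp add: z_def)
    then show thesis using that vM \<open>norm v = 1\<close> by blast
  next
    case False
    show thesis
    proof (rule that[of "complex_of_real (1 / norm z) *\<^sub>C z" \<alpha>])
      show "complex_of_real (1 / norm z) *\<^sub>C z \<in> M"
        by (intro complex_vector.subspace_scale[OF M(1)] \<open>z \<in> M\<close>)
      show "norm (complex_of_real (1 / norm z) *\<^sub>C z) = 1"
        using False by (simp add: norm_scaleC norm_divide)
      show "A (complex_of_real (1 / norm z) *\<^sub>C z) = \<alpha> *\<^sub>C complex_of_real (1 / norm z) *\<^sub>C z"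
        by (simp only: A_scaleC Az scaleC_scaleC mult.commute)
    qed
  qed
qed

lemma level_sum_scaleC: "w (c *\<^sub>C x) n = (cmod c)\<^sup>2 * w x n"
  by (simp add: level_sum_def cinner_scaleC_left norm_mult power_mult_distrib sum_distrib_left)

text \<open>
  On an eigenvector the levels form a geometric series of ratio \<open>\<bar>\<mu>\<bar>\<^sup>2\<close>, so
  \<open>(1 - \<bar>\<mu>\<bar>\<^sup>2) q x = w x 0\<close>. If \<open>w x 0\<close> vanished, so would \<open>q x\<close>.
\<close>

lemma eigenvector_level_sum:
  assumes x: "A x = \<mu> *\<^sub>C x" "x \<noteq> 0"
  shows "0 < w x 0" "cmod \<mu> < 1" "c1 * (1 - (cmod \<mu>)\<^sup>2) * (norm x)\<^sup>2 \<le> w x 0"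
proof -
  let ?q = "suminf (w x)"
  have "0 < c1 * (norm x)\<^sup>2" using c1_pos x(2) by simp
  also have "\<dots> \<le> ?q" by (rule lower)
  finally have q: "0 < ?q" .
  have step: "w x (Suc n) = (cmod \<mu>)\<^sup>2 * w x n" for n
    using fun_cong[OF level_sum_B_power[of 1 x], of n]
    by (simp add: eigenvector_adjoint[OF x(1)] level_sum_scaleC)
  have "?q = w x 0 + (cmod \<mu>)\<^sup>2 * ?q"
    using suminf_split_head[OF summable_level[of x]]
    by (simp add: step suminf_mult[OF summable_level])
  then have eq: "w x 0 = (1 - (cmod \<mu>)\<^sup>2) * ?q" by (simp add: algebra_simps)
  have "w x 0 \<noteq> 0"
  proof
    assume "w x 0 = 0"
    then have "w x n = 0" for n by (induction n) (simp_all add: step)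
    then have "w x = (\<lambda>_. 0)" by (rule ext)
    then have "?q = 0" by simp
    with q show False by simp
  qed
  then show pos: "0 < w x 0" using level_sum_nonneg[of A G x 0] by simp
  then have \<mu>: "0 < 1 - (cmod \<mu>)\<^sup>2" using q by (simp add: eq zero_less_mult_iff)
  then have "(cmod \<mu>)\<^sup>2 < 1\<^sup>2" by simp
  then show "cmod \<mu> < 1" by (rule power2_less_imp_less) simp
  have "(1 - (cmod \<mu>)\<^sup>2) * (c1 * (norm x)\<^sup>2) \<le> (1 - (cmod \<mu>)\<^sup>2) * ?q"
    using lower \<mu> by (intro mult_left_mono) auto
  then show "c1 * (1 - (cmod \<mu>)\<^sup>2) * (norm x)\<^sup>2 \<le> w x 0" by (simp add: eq mult_ac)
qed

text \<open>
  No nonzero eigenvector is orthogonal to all of \<open>G\<close>, so the coefficients \<open>\<langle>x, g\<rangle>\<close> determine \<open>x\<close>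
  within an eigenspace.
\<close>

lemma eigenspace_multiplicity:
  assumes E: "orthonormal E" "finite E" and eig: "\<And>e. e \<in> E \<Longrightarrow> A e = \<mu> *\<^sub>C e"
  shows "card E \<le> card G"
proof (rule ccontr)
  assume "\<not> ?thesis"
  then obtain c where c: "\<exists>e\<in>E. c e \<noteq> 0" "\<forall>g\<in>G. (\<Sum>e\<in>E. c e * cinner e g) = 0"
    using underdetermined_system[OF finite_G E(2), of cinner] by auto
  define x where "x = (\<Sum>e\<in>E. c e *\<^sub>C e)"
  have "(norm x)\<^sup>2 = (\<Sum>e\<in>E. (cmod (c e))\<^sup>2)"
    unfolding x_def using E by (intro power2_norm_orthonormal_sum) auto
  also have "\<dots> \<noteq> 0"
    using c(1) E(2) by (simp add: sum_nonneg_eq_0_iff)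
  finally have "x \<noteq> 0" by auto
  moreover have "A x = \<mu> *\<^sub>C x"
    by (simp add: x_def A.sum A_scaleC eig complex_vector.scale_sum_right scaleC_scaleC mult.commute)
  moreover have "w x 0 = 0"
    using c(2) by (simp add: level_sum_def x_def cinner_sum_left cinner_scaleC_left)
  ultimately show False using eigenvector_level_sum(1) by force
qed

lemma sum_level_sum_orthonormal_le:
  assumes "orthonormal E" "finite F" "F \<subseteq> E"
  shows "(\<Sum>e\<in>F. w e 0) \<le> (\<Sum>g\<in>G. (norm g)\<^sup>2)"
proof -
  have "cmod (cinner e g) = cmod (cinner g e)" for e g :: 'a
    by (metis cinner_commute complex_mod_cnj)
  then have "(\<Sum>e\<in>F. w e 0) = (\<Sum>e\<in>F. \<Sum>g\<in>G. (cmod (cinner g e))\<^sup>2)"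
    by (simp add: level_sum_def)
  also have "\<dots> = (\<Sum>g\<in>G. \<Sum>e\<in>F. (cmod (cinner g e))\<^sup>2)"
    by (rule sum.swap)
  also have "\<dots> \<le> (\<Sum>g\<in>G. (norm g)\<^sup>2)"
    by (intro sum_mono bessel_finite[OF assms])
  finally show ?thesis .
qed

text \<open>
  The orthogonal complement of a maximal orthonormal set of eigenvectors reduces \<open>A\<close>; if it were
  nonzero, it would contain a further eigenvector.
\<close>

lemma maximal_orthonormal_eigenvectors:
  obtains E where "orthonormal E" "\<And>e. e \<in> E \<Longrightarrow> \<exists>\<mu>. A e = \<mu> *\<^sub>C e"
    "\<And>x. (\<And>e. e \<in> E \<Longrightarrow> cinner x e = 0) \<Longrightarrow> x = 0"
proof -
  define S where "S = {E. orthonormal E \<and> (\<forall>e\<in>E. \<exists>\<mu>. A e = \<mu> *\<^sub>C e)}"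
  have "\<exists>E\<in>S. \<forall>X\<in>S. E \<subseteq> X \<longrightarrow> X = E"
  proof (rule subset_Zorn')
    fix \<C> assume "subset.chain S \<C>"
    then have \<C>: "\<C> \<subseteq> S" "\<And>X Y. X \<in> \<C> \<Longrightarrow> Y \<in> \<C> \<Longrightarrow> X \<subseteq> Y \<or> Y \<subseteq> X"
      by (auto simp: subset_chain_def)
    have "cinner x y = 0" if xy: "x \<in> \<Union>\<C>" "y \<in> \<Union>\<C>" "x \<noteq> y" for x y
    proof -
      obtain X where "X \<in> \<C>" "x \<in> X" "y \<in> X" using xy \<C>(2) by blast
      then show ?thesis using \<C>(1) xy(3) by (auto simp: S_def orthonormal_def)
    qed
    then show "\<Union>\<C> \<in> S"
      using \<C>(1) unfolding S_def orthonormal_def by fast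
  qed
  then obtain E where E: "E \<in> S" and max: "\<And>X. X \<in> S \<Longrightarrow> E \<subseteq> X \<Longrightarrow> X = E"
    by blast
  then have on: "orthonormal E" and eig: "\<And>e. e \<in> E \<Longrightarrow> \<exists>\<mu>. A e = \<mu> *\<^sub>C e"
    by (auto simp: S_def)
  define M where "M = {x. \<forall>e\<in>E. cinner x e = 0}"
  have "x = 0" if "x \<in> M" for x
  proof (rule ccontr)
    assume "x \<noteq> 0"
    have M: "complex_vector.subspace M"
      by (auto simp: complex_vector.subspace_def M_def cinner_add_left cinner_scaleC_left)
    have "M = (\<Inter>e\<in>E. {x. cinner x e = 0})" by (auto simp: M_def)
    moreover have "closed {x. cinner x e = 0}" for e :: 'a
      by (intro closed_Collect_eq linear_continuous_on bounded_linear_cinner_left continuous_on_const)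
    ultimately have "closed M" by auto
    have "A y \<in> M" if "y \<in> M" for y
      unfolding M_def
    proof safe
      fix e assume "e \<in> E"
      moreover from eig[OF this] obtain \<mu> where "A e = \<mu> *\<^sub>C e" by blast
      ultimately show "cinner (A y) e = 0"
        using that eigenvector_adjoint[of e \<mu>]
        by (simp add: adjoint cinner_scaleC_right M_def)
    qed
    moreover have "B y \<in> M" if "y \<in> M" for y
      unfolding M_def
    proof safe
      fix e assume "e \<in> E"
      moreover from eig[OF this] obtain \<mu> where "A e = \<mu> *\<^sub>C e" by blast
      ultimately show "cinner (B y) e = 0"
        using that by (simp add: adjoint' cinner_scaleC_right M_def)
    qed
    ultimately obtain v \<mu> where v: "v \<in> M" "norm v = 1" "A v = \<mu> *\<^sub>C v"
      by (rule reducing_subspace_has_eigenvector[OF M \<open>closed M\<close> _ _ \<open>x \<in> M\<close> \<open>x \<noteq> 0\<close>])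
    have "cinner v e = 0" "cinner e v = 0" if "e \<in> E" for e
    proof -
      show "cinner v e = 0" using v(1) that by (simp add: M_def)
      then show "cinner e v = 0" by (metis cinner_commute complex_cnj_zero)
    qed
    then have "insert v E \<in> S"
      using E v by (auto simp: S_def orthonormal_def)
    then have "v \<in> E" using max by blast
    with v(1) have "cinner v v = 0" unfolding M_def by blast
    with v(2) show False by simp
  qed
  with on eig that show thesis by (simp add: M_def)
qed

text \<open>
  Each basis vector contributes a positive amount \<open>w e 0\<close>, and the Bessel inequality bounds their
  total, so the basis is countable; infinite dimension makes it infinite.
\<close>

lemma orthonormal_eigenbasis:
  assumes inf: "\<not> cfinite_dim (UNIV :: 'a set)"
  obtains e :: "nat \<Rightarrow> 'a" and \<mu> where "inj e" "orthonormal (range e)"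
    "\<And>n. A (e n) = \<mu> n *\<^sub>C e n" "\<And>x. (\<And>n. cinner x (e n) = 0) \<Longrightarrow> x = 0"
proof -
  obtain E where E: "orthonormal E" "\<And>e. e \<in> E \<Longrightarrow> \<exists>\<mu>. A e = \<mu> *\<^sub>C e"
    and complete: "\<And>x. (\<And>e. e \<in> E \<Longrightarrow> cinner x e = 0) \<Longrightarrow> x = 0"
    using maximal_orthonormal_eigenvectors by blast
  have "(\<lambda>e. w e 0) summable_on E"
    using sum_level_sum_orthonormal_le[OF E(1)]
    by (intro nonneg_bdd_above_summable_on level_sum_nonneg bdd_aboveI2) auto
  then have "countable {e \<in> E. w e 0 \<noteq> 0}" by (rule summable_countable_real)
  moreover have "w e 0 \<noteq> 0" if e: "e \<in> E" for e
  proof -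
    obtain \<mu> where "A e = \<mu> *\<^sub>C e" using E(2)[OF e] by blast
    moreover have "e \<noteq> 0" using E(1) e by (auto simp: orthonormal_def)
    ultimately show ?thesis using eigenvector_level_sum(1) by force
  qed
  ultimately have count: "countable E" by (simp cong: conj_cong)
  have "infinite E"
  proof
    assume fin: "finite E"
    have "x \<in> cspan E" for x
    proof -
      have "x - (\<Sum>e\<in>E. cinner x e *\<^sub>C e) = 0"
      proof (rule complete)
        fix d assume d: "d \<in> E"
        have "cinner (\<Sum>e\<in>E. cinner x e *\<^sub>C e) d = (\<Sum>e\<in>E. if e = d then cinner x d else 0)"
          unfolding cinner_sum_left
          by (intro sum.cong refl) (simp add: cinner_scaleC_left orthonormal_cinner[OF E(1)] d)
        also have "\<dots> = cinner x d" using fin d by simp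
        finally show "cinner (x - (\<Sum>e\<in>E. cinner x e *\<^sub>C e)) d = 0"
          by (simp add: cinner_diff_left)
      qed
      then have "x = (\<Sum>e\<in>E. cinner x e *\<^sub>C e)" by simp
      also have "\<dots> \<in> cspan E"
        by (intro complex_vector.span_sum complex_vector.span_scale complex_vector.span_base)
      finally show ?thesis .
    qed
    then show False using inf fin unfolding cfinite_dim_def by blast
  qed
  with count have bij: "bij_betw (from_nat_into E) UNIV E" by (rule bij_betw_from_nat_into)
  then have range: "range (from_nat_into E) = E" by (simp add: bij_betw_def)
  then have "\<forall>n. \<exists>\<mu>. A (from_nat_into E n) = \<mu> *\<^sub>C from_nat_into E n" using E(2) by auto
  then obtain \<mu> where "\<And>n. A (from_nat_into E n) = \<mu> n *\<^sub>C from_nat_into E n" by metis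
  moreover have "x = 0" if "\<And>n. cinner x (from_nat_into E n) = 0" for x
    using complete[of x] that range by (metis imageE)
  moreover have "inj (from_nat_into E)" using bij by (simp add: bij_betw_def)
  ultimately show thesis using that E(1) range by metis
qed

lemma eigenbasis_multiplicity:
  fixes e :: "nat \<Rightarrow> 'a"
  assumes e: "inj e" "orthonormal (range e)" "\<And>n. A (e n) = \<mu> n *\<^sub>C e n"
  shows "finite {n. \<mu> n = l}" "card {n. \<mu> n = l} \<le> card G"
proof -
  have "card F \<le> card G" if F: "F \<subseteq> {n. \<mu> n = l}" "finite F" for F
  proof -
    have "orthonormal (e ` F)" using e(2) by (auto simp: orthonormal_def)
    moreover have "A d = l *\<^sub>C d" if "d \<in> e ` F" for d
      using that F(1) e(3) by auto
    ultimately have "card (e ` F) \<le> card G"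
      using F(2) by (intro eigenspace_multiplicity) auto
    then show ?thesis using e(1) by (simp add: card_image inj_on_subset)
  qed
  then show "finite {n. \<mu> n = l}" "card {n. \<mu> n = l} \<le> card G"
    using finite_if_finite_subsets_card_bdd[of "{n. \<mu> n = l}" "card G"] by blast+
qed

text \<open>
  The distances \<open>1 - \<bar>\<mu> n\<bar>\<^sup>2\<close> are dominated by the summable sequence \<open>w (e n) 0 / c1\<close>.
\<close>

lemma eigenvalues_tendsto_circle:
  fixes e :: "nat \<Rightarrow> 'a"
  assumes e: "inj e" "orthonormal (range e)" "\<And>n. A (e n) = \<mu> n *\<^sub>C e n"
  shows "(\<lambda>n. cmod (\<mu> n)) \<longlonglongrightarrow> 1"
proof -
  have e1: "norm (e n) = 1" for n using e(2) by (simp add: orthonormal_def)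
  then have e0: "e n \<noteq> 0" for n using norm_zero zero_neq_one by metis
  have "summable (\<lambda>n. w (e n) 0)"
  proof (rule summableI_nonneg_bounded[OF level_sum_nonneg])
    fix N
    have "(\<Sum>n<N. w (e n) 0) = (\<Sum>d\<in>e ` {..<N}. w d 0)"
      using e(1) by (subst sum.reindex) (auto intro: inj_on_subset)
    also have "\<dots> \<le> (\<Sum>g\<in>G. (norm g)\<^sup>2)"
      using e(2) by (intro sum_level_sum_orthonormal_le) auto
    finally show "(\<Sum>n<N. w (e n) 0) \<le> (\<Sum>g\<in>G. (norm g)\<^sup>2)" .
  qed
  then have lim: "(\<lambda>n. w (e n) 0 / c1) \<longlonglongrightarrow> 0 / c1"
    using c1_pos by (intro tendsto_intros summable_LIMSEQ_zero) auto
  have "(\<lambda>n. 1 - (cmod (\<mu> n))\<^sup>2) \<longlonglongrightarrow> 0"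
  proof (rule tendsto_sandwich[where f = "\<lambda>_. 0" and h = "\<lambda>n. w (e n) 0 / c1"])
    have "0 \<le> 1 - (cmod (\<mu> n))\<^sup>2" for n
      using eigenvector_level_sum(2)[OF e(3) e0, of n] by (simp add: power_le_one)
    then show "\<forall>\<^sub>F n in sequentially. 0 \<le> 1 - (cmod (\<mu> n))\<^sup>2" by simp
    have "1 - (cmod (\<mu> n))\<^sup>2 \<le> w (e n) 0 / c1" for n
      using eigenvector_level_sum(3)[OF e(3) e0, of n] c1_pos by (simp add: e1 field_simps)
    then show "\<forall>\<^sub>F n in sequentially. 1 - (cmod (\<mu> n))\<^sup>2 \<le> w (e n) 0 / c1" by simp
  qed (use lim in auto)
  from tendsto_diff[OF tendsto_const[of 1] this]
  have "(\<lambda>n. (cmod (\<mu> n))\<^sup>2) \<longlonglongrightarrow> 1" by simp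
  from tendsto_real_sqrt[OF this] show ?thesis by simp
qed

end

section \<open>The Hilbert space of square-summable sequences as a model\<close>

instance chilbert_space \<subseteq> banach ..

lemma sums_orthonormal_expansion:
  fixes e :: "nat \<Rightarrow> 'a::chilbert_space"
  assumes e: "inj e" "orthonormal (range e)" and c: "summable (\<lambda>n. (cmod (c n))\<^sup>2)"
  shows "summable (\<lambda>n. c n *\<^sub>C e n)" "cinner (\<Sum>n. c n *\<^sub>C e n) (e k) = c k"
proof -
  have block: "(norm (\<Sum>n\<in>{m..<k}. c n *\<^sub>C e n))\<^sup>2 = (\<Sum>n\<in>{m..<k}. (cmod (c n))\<^sup>2)" for m k
  proof -
    have inj: "inj_on e {m..<k}" using e(1) by (rule inj_on_subset) simp
    have inv: "inv e (e n) = n" for n using e(1) by simp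
    have "(norm (\<Sum>d\<in>e ` {m..<k}. c (inv e d) *\<^sub>C d))\<^sup>2
        = (\<Sum>d\<in>e ` {m..<k}. (cmod (c (inv e d)))\<^sup>2)"
      by (rule power2_norm_orthonormal_sum[OF e(2)]) auto
    then show ?thesis by (simp add: sum.reindex[OF inj] inv)
  qed
  show sum: "summable (\<lambda>n. c n *\<^sub>C e n)"
    unfolding summable_Cauchy
  proof (intro allI impI)
    fix r :: real assume r: "0 < r"
    then obtain N where N: "\<And>m k. m \<ge> N \<Longrightarrow> norm (\<Sum>n\<in>{m..<k}. (cmod (c n))\<^sup>2) < r\<^sup>2"
      using c unfolding summable_Cauchy by (meson zero_less_power)
    have "norm (\<Sum>n\<in>{m..<k}. c n *\<^sub>C e n) < r" if "m \<ge> N" for m k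
    proof (rule power2_less_imp_less[OF _ less_imp_le[OF r]])
      show "(norm (\<Sum>n\<in>{m..<k}. c n *\<^sub>C e n))\<^sup>2 < r\<^sup>2"
        using N[OF that, of k] by (simp add: block sum_nonneg)
    qed
    then show "\<exists>N. \<forall>m\<ge>N. \<forall>k. norm (\<Sum>n\<in>{m..<k}. c n *\<^sub>C e n) < r" by blast
  qed
  have "cinner (c n *\<^sub>C e n) (e k) = (if n = k then c n else 0)" for n
    using orthonormal_cinner[OF e(2), of "e n" "e k"] e(1)
    by (simp add: cinner_scaleC_left inj_eq)
  moreover have "(\<lambda>n. if n = k then c n else 0) sums c k"
    by (rule sums_single)
  moreover have "(\<lambda>n. cinner (c n *\<^sub>C e n) (e k)) sums cinner (\<Sum>n. c n *\<^sub>C e n) (e k)"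
    by (intro bounded_linear.sums[OF bounded_linear_cinner_left] summable_sums sum)
  ultimately show "cinner (\<Sum>n. c n *\<^sub>C e n) (e k) = c k"
    by (simp add: sums_unique2)
qed

text \<open>
  The coefficient map of a complete orthonormal sequence: completeness gives Parseval, and completeness
  of the space gives surjectivity.
\<close>

lemma orthonormal_basis_unitary:
  fixes e :: "nat \<Rightarrow> 'a::chilbert_space"
  assumes e: "inj e" "orthonormal (range e)"
    and complete: "\<And>x. (\<And>n. cinner x (e n) = 0) \<Longrightarrow> x = 0"
  obtains U :: "'a \<Rightarrow> ell2" where "unitary_op U" "\<And>x n. ell2_nth (U x) n = cinner x (e n)"
proof -
  have coeffs: "summable (\<lambda>n. (cmod (cinner x (e n)))\<^sup>2)" for x
  proof (rule summableI_nonneg_bounded)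
    fix N
    have "(\<Sum>n<N. (cmod (cinner x (e n)))\<^sup>2) = (\<Sum>d\<in>e ` {..<N}. (cmod (cinner x d))\<^sup>2)"
      using e(1) by (subst sum.reindex) (auto intro: inj_on_subset)
    also have "\<dots> \<le> (norm x)\<^sup>2"
      using e(2) by (intro bessel_finite) auto
    finally show "(\<Sum>n<N. (cmod (cinner x (e n)))\<^sup>2) \<le> (norm x)\<^sup>2" .
  qed simp
  define U where "U x = Abs_ell2 (\<lambda>n. cinner x (e n))" for x
  have U: "ell2_nth (U x) n = cinner x (e n)" for x n
    using coeffs[of x] by (simp add: U_def Abs_ell2_inverse)
  have iso: "cinner (U x) (U y) = cinner x y" for x y
  proof -
    let ?c = "\<lambda>n. cinner x (e n)"
    have "x - (\<Sum>n. ?c n *\<^sub>C e n) = 0"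
      by (rule complete) (simp add: cinner_diff_left sums_orthonormal_expansion(2)[OF e coeffs])
    then have "(\<lambda>n. ?c n *\<^sub>C e n) sums x"
      using summable_sums[OF sums_orthonormal_expansion(1)[OF e coeffs, of x]] by simp
    then have "(\<lambda>n. cinner (?c n *\<^sub>C e n) y) sums cinner x y"
      by (rule bounded_linear.sums[OF bounded_linear_cinner_left])
    moreover have "cinner (?c n *\<^sub>C e n) y = ell2_nth (U x) n * cnj (ell2_nth (U y) n)" for n
      using cinner_commute[of "e n" y] by (simp add: U cinner_scaleC_left)
    ultimately show ?thesis by (simp add: cinner_ell2.rep_eq sums_iff)
  qed
  have "(norm (U x))\<^sup>2 = (norm x)\<^sup>2" for x
    by (simp only: power2_norm_eq_Re_cinner iso)
  then have norm: "norm (U x) = norm x" for x by (simp add: power2_eq_iff_nonneg)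
  have add: "U (x + y) = U x + U y" for x y
    by (intro ell2_nth_inject[THEN iffD1] ext) (simp add: U plus_ell2.rep_eq cinner_add_left)
  have scale: "U (c *\<^sub>C x) = c *\<^sub>C U x" for c x
    by (intro ell2_nth_inject[THEN iffD1] ext) (simp add: U scaleC_ell2.rep_eq cinner_scaleC_left)
  have "bounded_clinear U"
    unfolding bounded_clinear_def
    by (intro conjI allI scale bounded_linear_intro[where K = 1])
       (simp_all add: add scale scaleR_scaleC norm)
  moreover have "surj U"
  proof (rule surjI)
    fix y
    have "summable (\<lambda>n. (cmod (ell2_nth y n))\<^sup>2)" using ell2_nth[of y] by simp
    then show "U (\<Sum>n. ell2_nth y n *\<^sub>C e n) = y"
      by (intro ell2_nth_inject[THEN iffD1] ext)
        (simp add: U sums_orthonormal_expansion(2)[OF e])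
  qed
  ultimately have "unitary_op U" by (simp add: unitary_op_def iso)
  with U that show thesis by blast
qed

text \<open>
  Meaningful only if the pointwise product is square-summable again, in particular for bounded \<open>d\<close>.
\<close>

definition ell2_mult :: "(nat \<Rightarrow> complex) \<Rightarrow> ell2 \<Rightarrow> ell2" where
  "ell2_mult d x = Abs_ell2 (\<lambda>n. d n * ell2_nth x n)"

lemma ell2_eqI: "(\<And>n. ell2_nth x n = ell2_nth y n) \<Longrightarrow> x = y"
  by (intro ell2_nth_inject[THEN iffD1] ext)

lemma summable_ell2_nth: "summable (\<lambda>n. (cmod (ell2_nth x n))\<^sup>2)"
  using ell2_nth[of x] by simp

lemma ell2_mult_bound:
  assumes "\<And>n. cmod (d n) \<le> K"
  shows "(cmod (d n * z))\<^sup>2 \<le> K\<^sup>2 * (cmod z)\<^sup>2"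
  unfolding norm_mult power_mult_distrib
  by (intro mult_right_mono power_mono assms) auto

lemma ell2_nth_mult:
  assumes "\<And>n. cmod (d n) \<le> K"
  shows "ell2_nth (ell2_mult d x) n = d n * ell2_nth x n"
proof -
  have "summable (\<lambda>n. (cmod (d n * ell2_nth x n))\<^sup>2)"
    by (rule summable_comparison_test'[OF summable_mult[OF summable_ell2_nth[of x], of "K\<^sup>2"]])
       (use ell2_mult_bound[OF assms] in auto)
  then show ?thesis by (simp add: ell2_mult_def Abs_ell2_inverse)
qed

lemma bounded_clinear_ell2_mult:
  assumes d: "\<And>n. cmod (d n) \<le> K"
  shows "bounded_clinear (ell2_mult d)"
proof -
  note nth = ell2_nth_mult[OF d]
  have K: "0 \<le> K" using d[of 0] norm_ge_zero order_trans by blast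
  have add: "ell2_mult d (x + y) = ell2_mult d x + ell2_mult d y" for x y
    by (rule ell2_eqI) (simp add: nth plus_ell2.rep_eq distrib_left)
  have scale: "ell2_mult d (c *\<^sub>C x) = c *\<^sub>C ell2_mult d x" for c x
    by (rule ell2_eqI) (simp add: nth scaleC_ell2.rep_eq)
  have "norm (ell2_mult d x) \<le> norm x * K" for x
  proof -
    have s: "summable (\<lambda>n. (cmod (d n * ell2_nth x n))\<^sup>2)"
      using summable_ell2_nth[of "ell2_mult d x"] by (simp add: nth)
    have "(\<Sum>n. (cmod (d n * ell2_nth x n))\<^sup>2) \<le> (\<Sum>n. K\<^sup>2 * (cmod (ell2_nth x n))\<^sup>2)"
      by (intro suminf_le ell2_mult_bound d s summable_mult summable_ell2_nth)
    also have "\<dots> = K\<^sup>2 * (\<Sum>n. (cmod (ell2_nth x n))\<^sup>2)"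
      by (rule suminf_mult[OF summable_ell2_nth])
    finally have "norm (ell2_mult d x) \<le> sqrt (K\<^sup>2 * (\<Sum>n. (cmod (ell2_nth x n))\<^sup>2))"
      by (simp add: norm_ell2.rep_eq nth del: real_sqrt_mult)
    then show ?thesis using K by (simp add: norm_ell2.rep_eq real_sqrt_mult mult.commute)
  qed
  then have "bounded_linear (ell2_mult d)"
    by (intro bounded_linear_intro[where K = K]) (simp_all add: add scale scaleR_scaleC)
  with scale show ?thesis by (simp add: bounded_clinear_def)
qed

lemma ell2_nth_mult_of_bool:
  "ell2_nth (ell2_mult (\<lambda>n. of_bool (Q n)) x) n = of_bool (Q n) * ell2_nth x n"
  by (rule ell2_nth_mult[where K = 1]) simp

lemma orth_projection_ell2_mult: "orth_projection (ell2_mult (\<lambda>n. of_bool (Q n)))"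
proof -
  have "bounded_clinear (ell2_mult (\<lambda>n. of_bool (Q n)))"
    by (rule bounded_clinear_ell2_mult[where K = 1]) simp
  moreover have "ell2_mult (\<lambda>n. of_bool (Q n)) (ell2_mult (\<lambda>n. of_bool (Q n)) x)
      = ell2_mult (\<lambda>n. of_bool (Q n)) x" for x
    by (rule ell2_eqI) (simp add: ell2_nth_mult_of_bool)
  moreover have "cinner (ell2_mult (\<lambda>n. of_bool (Q n)) x) y
      = cinner x (ell2_mult (\<lambda>n. of_bool (Q n)) y)" for x y
    unfolding cinner_ell2.rep_eq ell2_nth_mult_of_bool
    by (intro arg_cong[of _ _ suminf] ext) simp
  ultimately show ?thesis
    by (auto simp: orth_projection_def is_cadjoint_def)
qed

lemma ell2_nth_sum: "ell2_nth (\<Sum>i\<in>I. f i) n = (\<Sum>i\<in>I. ell2_nth (f i) n)"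
  by (induction I rule: infinite_finite_induct) (simp_all add: zero_ell2.rep_eq plus_ell2.rep_eq)

text \<open>
  The index \<open>k n\<close> says to which level set the coordinate \<open>n\<close> belongs. Each coordinate receives its
  final value after finitely many partial sums, and the remainders are dominated by a multiple of \<open>x\<close>,
  so dominated convergence for series gives convergence in norm. With \<open>s = 1\<close> this is the resolution
  of the identity, with \<open>s\<close> the eigenvalues the diagonal expansion.
\<close>

lemma sums_ell2_mult:
  fixes k :: "nat \<Rightarrow> nat"
  assumes s: "\<And>j. cmod (s j) \<le> K"
  shows "(\<lambda>j. s j *\<^sub>C ell2_mult (\<lambda>n. of_bool (k n = j)) x) sums ell2_mult (\<lambda>n. s (k n)) x"
proof -
  define y where "y N = ell2_mult (\<lambda>n. s (k n)) x
      - (\<Sum>j<N. s j *\<^sub>C ell2_mult (\<lambda>n. of_bool (k n = j)) x)" for N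
  have y: "ell2_nth (y N) n = (if k n < N then 0 else s (k n) * ell2_nth x n)" for N n
  proof -
    have "(\<Sum>j<N. s j * (of_bool (k n = j) * ell2_nth x n))
        = (\<Sum>j<N. if j = k n then s (k n) * ell2_nth x n else 0)"
      by (intro sum.cong) auto
    then show ?thesis
      by (simp add: y_def minus_ell2.rep_eq ell2_nth_sum scaleC_ell2.rep_eq ell2_nth_mult_of_bool
          ell2_nth_mult[OF s])
  qed
  have "(\<lambda>N. \<Sum>n. (cmod (ell2_nth (y N) n))\<^sup>2) \<longlonglongrightarrow> (\<Sum>n. 0)"
  proof (rule tannerys_theorem[THEN conjunct2, THEN conjunct2])
    show "(\<lambda>N. (cmod (ell2_nth (y N) n))\<^sup>2) \<longlonglongrightarrow> 0" for n
      by (intro tendsto_eventually eventually_sequentiallyI[of "Suc (k n)"]) (simp add: y)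
    have "norm ((cmod (ell2_nth (y N) n))\<^sup>2) \<le> K\<^sup>2 * (cmod (ell2_nth x n))\<^sup>2" for N n
      using ell2_mult_bound[where d = s and n = "k n" and z = "ell2_nth x n", OF s] by (simp add: y)
    then show "\<forall>\<^sub>F (n, N) in sequentially \<times>\<^sub>F sequentially.
        norm ((cmod (ell2_nth (y N) n))\<^sup>2) \<le> K\<^sup>2 * (cmod (ell2_nth x n))\<^sup>2"
      by (simp add: case_prod_unfold)
    show "summable (\<lambda>n. K\<^sup>2 * (cmod (ell2_nth x n))\<^sup>2)"
      by (intro summable_mult summable_ell2_nth)
  qed simp
  from tendsto_real_sqrt[OF this] have "(\<lambda>N. norm (y N)) \<longlonglongrightarrow> 0"
    by (simp add: norm_ell2.rep_eq)
  then have "y \<longlonglongrightarrow> 0" by (simp add: tendsto_norm_zero_iff)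
  from tendsto_diff[OF tendsto_const[of "ell2_mult (\<lambda>n. s (k n)) x"] this]
  show ?thesis by (simp add: sums_def y_def)
qed

lift_definition ell2_unit :: "nat \<Rightarrow> ell2" is "\<lambda>k n. of_bool (n = k)"
proof -
  fix k :: nat
  have "(\<lambda>n. (cmod (of_bool (n = k)))\<^sup>2) = (\<lambda>n. if n = k then 1 else 0)" by auto
  then show "summable (\<lambda>n. (cmod (of_bool (n = k)))\<^sup>2)" by simp
qed

lemma cdim_le_range_ell2_mult:
  assumes S: "finite S" "card S \<le> m"
  shows "cdim_le (range (ell2_mult (\<lambda>n. of_bool (n \<in> S)))) m"
proof -
  have "ell2_mult (\<lambda>n. of_bool (n \<in> S)) x \<in> cspan (ell2_unit ` S)" for x
  proof -
    have "ell2_mult (\<lambda>n. of_bool (n \<in> S)) x = (\<Sum>k\<in>S. ell2_nth x k *\<^sub>C ell2_unit k)"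
    proof (rule ell2_eqI)
      fix n
      have "(\<Sum>k\<in>S. ell2_nth x k * of_bool (n = k)) = (\<Sum>k\<in>S. if k = n then ell2_nth x n else 0)"
        by (intro sum.cong) auto
      then show "ell2_nth (ell2_mult (\<lambda>n. of_bool (n \<in> S)) x) n
          = ell2_nth (\<Sum>k\<in>S. ell2_nth x k *\<^sub>C ell2_unit k) n"
        using S(1) by (simp add: ell2_nth_mult_of_bool ell2_nth_sum scaleC_ell2.rep_eq ell2_unit.rep_eq)
    qed
    also have "\<dots> \<in> cspan (ell2_unit ` S)"
      by (intro complex_vector.span_sum complex_vector.span_scale complex_vector.span_base) auto
    finally show ?thesis .
  qed
  then have sub: "range (ell2_mult (\<lambda>n. of_bool (n \<in> S))) \<subseteq> cspan (ell2_unit ` S)" by auto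
  then have "cdim (range (ell2_mult (\<lambda>n. of_bool (n \<in> S)))) \<le> card (ell2_unit ` S)"
    using S(1) by (intro complex_vector.dim_le_card) auto
  also have "\<dots> \<le> m" using card_image_le[OF S(1), of ell2_unit] S(2) by linarith
  finally show ?thesis using sub S(1) unfolding cdim_le_def cfinite_dim_def by blast
qed

theorem corollary1:
  fixes A :: "'h::chilbert_space \<Rightarrow> 'h" and G :: "'h set"
  assumes infinite_dim: "\<not> cfinite_dim (UNIV :: 'h set)"
    and separable: "separable_space (euclidean :: 'h topology)"
    and normal: "normal_op A"
    and finite_G: "finite G"
    and frame: "is_frame (G \<times> (UNIV :: nat set)) (\<lambda>(g, n). (A ^^ n) g)"
  shows "\<exists>(\<Lambda> :: ell2 \<Rightarrow> ell2) (lam :: nat \<Rightarrow> complex) (P :: nat \<Rightarrow> ell2 \<Rightarrow> ell2).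
           unitarily_equivalent A \<Lambda> \<and>
           inj lam \<and>
           (\<forall>j. orth_projection (P j) \<and> P j \<noteq> (\<lambda>_. 0) \<and>
                range (P j) = eigenspace \<Lambda> (lam j)) \<and>
           (\<forall>i j. i \<noteq> j \<longrightarrow> P i \<circ> P j = (\<lambda>_. 0)) \<and>
           (\<forall>x. (\<lambda>j. P j x) sums x) \<and>
           (\<forall>x. (\<lambda>j. lam j *\<^sub>C P j x) sums \<Lambda> x) \<and>
           (\<forall>j. cdim_le (range (P j)) (card G)) \<and>
           (card G = 1 \<longrightarrow>
              (\<forall>j. cmod (lam j) < 1) \<and> (\<lambda>j. cmod (lam j)) \<longlonglongrightarrow> 1)"
proof -
  obtain B where B: "is_cadjoint B A" "A \<circ> B = B \<circ> A" and "bounded_clinear A"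
    using normal by (auto simp: normal_op_def)
  then interpret normal_pair A B
    by unfold_locales (auto simp: is_cadjoint_def fun_eq_iff)
  obtain c1 c2 where "0 < c1" "\<And>x. summable (level_sum A G x)"
    "\<And>x. c1 * (norm x)\<^sup>2 \<le> suminf (level_sum A G x)"
    "\<And>x. suminf (level_sum A G x) \<le> c2 * (norm x)\<^sup>2"
    using is_frame_level_sums[OF finite_G frame] by blast
  then interpret normal_frame A B G c1 c2
    by unfold_locales (auto simp: finite_G)
  obtain e :: "nat \<Rightarrow> 'h" and \<mu> where e: "inj e" "orthonormal (range e)"
      and eig: "\<And>n. A (e n) = \<mu> n *\<^sub>C e n" and complete: "\<And>x. (\<And>n. cinner x (e n) = 0) \<Longrightarrow> x = 0"
    using orthonormal_eigenbasis[OF infinite_dim] by blast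
  obtain U :: "'h \<Rightarrow> ell2" where U: "unitary_op U" "\<And>x n. ell2_nth (U x) n = cinner x (e n)"
    using orthonormal_basis_unitary[OF e complete] by blast
  have "norm (e n) = 1" for n using e(2) by (simp add: orthonormal_def)
  then have "e n \<noteq> 0" for n using norm_zero zero_neq_one by metis
  then have \<mu>_less: "cmod (\<mu> n) < 1" for n
    using eigenvector_level_sum(2)[OF eig] by blast
  then have \<mu>_le: "cmod (\<mu> n) \<le> 1" for n using less_imp_le by blast
  note fiber = eigenbasis_multiplicity[OF e eig]

  \<comment> \<open>The fibers of \<open>\<mu>\<close> are finite, so there are infinitely many distinct eigenvalues and they can be
    listed without repetition by the natural numbers.\<close>
  have "infinite (range \<mu>)"
  proof
    assume "finite (range \<mu>)"
    then have "finite (\<Union>l\<in>range \<mu>. {n. \<mu> n = l})" by (intro finite_UN_I fiber)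
    moreover have "(\<Union>l\<in>range \<mu>. {n. \<mu> n = l}) = UNIV" by auto
    ultimately show False by simp
  qed
  then have lam_bij: "bij_betw (from_nat_into (range \<mu>)) UNIV (range \<mu>)"
    by (intro bij_betw_from_nat_into) auto
  define lam where "lam = from_nat_into (range \<mu>)"
  have lam: "inj lam" "range lam = range \<mu>"
    using lam_bij by (auto simp: lam_def bij_betw_def)
  define k where "k n = inv lam (\<mu> n)" for n
  have lam_k: "lam (k n) = \<mu> n" for n
    unfolding k_def using lam(2) by (intro f_inv_into_f) auto
  then have k_iff: "k n = j \<longleftrightarrow> \<mu> n = lam j" for n j
    using lam(1) by (metis injD)
  have "\<forall>j. \<exists>n. lam j = \<mu> n" using lam(2) by (metis rangeI imageE)
  then obtain m where m: "\<And>j. lam j = \<mu> (m j)" by metis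
  have lam_le: "cmod (lam j) \<le> 1" for j by (simp add: m \<mu>_le)

  define P where "P j = ell2_mult (\<lambda>n. of_bool (k n = j))" for j
  define \<Lambda> where "\<Lambda> = ell2_mult \<mu>"
  have P_nth: "ell2_nth (P j x) n = of_bool (k n = j) * ell2_nth x n" for j x n
    by (simp add: P_def ell2_nth_mult_of_bool)
  have \<Lambda>_nth: "ell2_nth (\<Lambda> x) n = \<mu> n * ell2_nth x n" for x n
    by (simp add: \<Lambda>_def ell2_nth_mult[OF \<mu>_le])

  have "U (A x) = \<Lambda> (U x)" for x
    by (rule ell2_eqI) (simp add: U(2) \<Lambda>_nth adjoint eigenvector_adjoint[OF eig] cinner_scaleC_right)
  then have equiv: "unitarily_equivalent A \<Lambda>"
    using U(1) by (auto simp: unitarily_equivalent_def fun_eq_iff)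
  have proj: "orth_projection (P j)" for j
    unfolding P_def by (rule orth_projection_ell2_mult)
  have nonzero: "P j \<noteq> (\<lambda>_. 0)" for j
  proof
    assume "P j = (\<lambda>_. 0)"
    then have "ell2_nth (P j (ell2_unit (m j))) (m j) = 0" by (simp add: zero_ell2.rep_eq)
    then show False by (simp add: P_nth k_iff m ell2_unit.rep_eq)
  qed
  have range: "range (P j) = eigenspace \<Lambda> (lam j)" for j
  proof
    show "range (P j) \<subseteq> eigenspace \<Lambda> (lam j)"
      by (auto simp: eigenspace_def P_nth \<Lambda>_nth scaleC_ell2.rep_eq k_iff intro!: ell2_eqI)
    show "eigenspace \<Lambda> (lam j) \<subseteq> range (P j)"
    proof
      fix x assume "x \<in> eigenspace \<Lambda> (lam j)"
      then have "\<mu> n * ell2_nth x n = lam j * ell2_nth x n" for n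
        by (metis (mono_tags) eigenspace_def mem_Collect_eq \<Lambda>_nth scaleC_ell2.rep_eq)
      then have "P j x = x" by (intro ell2_eqI) (auto simp: P_nth k_iff)
      then show "x \<in> range (P j)" by (metis rangeI)
    qed
  qed
  have orth: "P i \<circ> P j = (\<lambda>_. 0)" if "i \<noteq> j" for i j
    using that by (auto simp: P_nth zero_ell2.rep_eq intro!: ext ell2_eqI)
  have id: "(\<lambda>j. P j x) sums x" for x
  proof -
    have "ell2_mult (\<lambda>n. 1) x = x"
      by (rule ell2_eqI) (simp add: ell2_nth_mult[where K = 1])
    then show ?thesis
      using sums_ell2_mult[where s = "\<lambda>_. 1" and K = 1 and k = k and x = x] by (simp add: P_def)
  qed
  have diag: "(\<lambda>j. lam j *\<^sub>C P j x) sums \<Lambda> x" for x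
    using sums_ell2_mult[where s = lam and K = 1 and k = k and x = x, OF lam_le] by (simp add: P_def \<Lambda>_def lam_k)
  have dim: "cdim_le (range (P j)) (card G)" for j
    using cdim_le_range_ell2_mult[OF fiber, of "lam j"] by (simp add: P_def k_iff)
  have less: "cmod (lam j) < 1" for j by (simp add: m \<mu>_less)
  \<comment> \<open>The distinct eigenvalues form a subfamily of \<open>\<mu>\<close> along an injection, which tends to infinity.\<close>
  have "inj m" using lam(1) by (metis injI injD m)
  have "filterlim m sequentially sequentially"
    unfolding cofinite_eq_sequentially[symmetric] filterlim_iff eventually_cofinite
  proof (intro allI impI)
    fix Q :: "nat \<Rightarrow> bool" assume "finite {n. \<not> Q n}"
    from finite_vimageI[OF this \<open>inj m\<close>] show "finite {j. \<not> Q (m j)}"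
      by (simp add: vimage_def)
  qed
  from filterlim_compose[OF eigenvalues_tendsto_circle[OF e eig] this]
  have "(\<lambda>j. cmod (lam j)) \<longlonglongrightarrow> 1" by (simp add: m)
  then show ?thesis
    using equiv lam(1) proj nonzero range orth id diag dim less by blast
qed

end
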